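(* Let $p\in[2,\infty)$ and $\delta\ge0$. Moreover, let $\mathbf A\in(L^p(\Omega))^{d\times d}$ with $\mu_{\mathbf A}:=(\delta+|\overline{\mathbf A}|)^{p-2}\in A_2(\mathbb R^d)$. Then Bogovskiĭ's operator $\mathcal B_{\mathrm{Bog}}\colon C^\infty_{0,0}(\Omega)\to(C^\infty_0(\Omega))^d$ uniquely extends to a continuous operator from $L^{\varphi_{|\mathbf A|}}_0(\Omega)$ to $(W^{1,\varphi_{|\mathbf A|}}_0(\Omega))^d$. In particular, there exists a constant $c>0$, depending on $p$, $\Omega$ and $[\mu_{\mathbf A}]_{A_2(\mathbb R^d)}$, such that for every $z\in L^{\varphi_{|\mathbf A|}}_0(\Omega)$ it holds that $$\rho_{\varphi_{|\mathbf A|},\Omega}(\nabla\mathcal B_{\mathrm{Bog}}z)\le c\,\rho_{\varphi_{|\mathbf A|},\Omega}(z)\,.$$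
   Context: $\Omega\subseteq\mathbb R^d$, $d\in\{2,3\}$, is a bounded, polygonal ($d=2$) or polyhedral ($d=3$) Lipschitz domain. $\overline{\mathbf A}$ is the extension of $\mathbf A$ by $\mathbf 0$ to $\mathbb R^d$. N-functions: $\varphi=\varphi_{p,\delta}$, $\varphi(t)=\int_0^t(\delta+s)^{p-2}s\,ds$; for $a\ge0$ the shifted N-function is $\varphi_a(t)=\int_0^t\varphi'(a+s)\frac{s}{a+s}\,ds$. For a generalized ($x$-dependent) N-function $\psi$, $\rho_{\psi,\Omega}(u)=\int_\Omega\psi(x,|u(x)|)\,dx$; $\varphi_{|\mathbf A|}$ stands for $(x,t)\mapsto\varphi_{|\mathbf A(x)|}(t)$. $L^{\psi}(\Omega)$ is the (Musielak–)Orlicz space of measurable $u$ with $\rho_{\psi,\Omega}(\lambda u)<\infty$ for some $\lambda>0$, with the Luxemburg norm; $L^\psi_0(\Omega)$ is its subspace of functions with zero mean; $W^{1,\psi}_0(\Omega)$ is the space of functions in $W^{1,1}_0(\Omega)$ which, together with their gradient, belong to $L^\psi(\Omega)$. A weight $\sigma$ on $\mathbb R^d$ ($\sigma\in L^1_{\mathrm{loc}}(\mathbb R^d)$, $0<\sigma<\infty$ a.e.) is in $A_s(\mathbb R^d)$, $1<s<\infty$, if $[\sigma]_{A_s(\mathbb R^d)}=\sup_B\langle\sigma\rangle_B(\langle\sigma^{1-s'}\rangle_B)^{s-1}<\infty$, supremum over all balls $B$, $\langle\cdot\rangle_B$ denoting the mean value over $B$ and $s'=s/(s-1)$. $C^\infty_{0,0}(\Omega)$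 is the space of functions in $C^\infty_0(\Omega)$ with zero mean. $\mathcal B_{\mathrm{Bog}}$ is the (fixed) Bogovskiĭ operator of $\Omega$ from the literature: a linear operator $C^\infty_{0,0}(\Omega)\to(C^\infty_0(\Omega))^d$ with $\mathrm{div}\,\mathcal B_{\mathrm{Bog}}z=z$, which for every $s\in(1,\infty)$ and every $\sigma\in A_s(\mathbb R^d)$ extends uniquely to a continuous operator from $L^s_0(\Omega;\sigma)$ to $(W^{1,s}_0(\Omega;\sigma))^d$ with $\|\nabla\mathcal B_{\mathrm{Bog}}z\|_{L^s(\Omega;\sigma)}\le C\|z\|_{L^s(\Omega;\sigma)}$, where $C$ depends only on $\Omega$, $s$ and $[\sigma]_{A_s(\mathbb R^d)}$; here $\|u\|_{L^s(\Omega;\sigma)}=(\int_\Omega|u|^s\sigma\,dx)^{1/s}$. *)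

theory Defs
  imports "HOL-Analysis.Analysis"
begin

text \<open>Functions on a domain \<open>\<Omega>\<close> are total functions on the whole space of which only the values
  on \<open>\<Omega>\<close> matter; elements of Lebesgue, Orlicz and Sobolev spaces are represented by such functions
  and identified when they agree almost everywhere on \<open>\<Omega>\<close>.\<close>

subsection \<open>Domains\<close>

text \<open>Near every boundary point, and in a suitable orthonormal coordinate system with last axis
  \<open>e\<close>, the set is the strict epigraph of a Lipschitz function \<open>g\<close>. The function \<open>g\<close> of the other
  coordinates is modelled as a function on the hyperplane orthogonal to \<open>e\<close>.\<close>

definition lipschitz_domain :: "(real^'d) set \<Rightarrow> bool" where
  "lipschitz_domain \<Omega> \<longleftrightarrow>
     open \<Omega> \<and> connected \<Omega> \<and> \<Omega> \<noteq> {} \<and>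
     (\<forall>x \<in> frontier \<Omega>. \<exists>r>0. \<exists>e g L. norm e = 1 \<and> L-lipschitz_on {v. v \<bullet> e = 0} (g :: real^'d \<Rightarrow> real) \<and>
        \<Omega> \<inter> ball x r = {y \<in> ball x r. g (y - (y \<bullet> e) *\<^sub>R e) < y \<bullet> e})"

text \<open>The boundary consists of finitely many segments (dimension 2) or convex polygons
  (dimension 3); a non-convex face is a union of convex ones.\<close>

definition polyhedral_boundary :: "(real^'d) set \<Rightarrow> bool" where
  "polyhedral_boundary \<Omega> \<longleftrightarrow>
     (\<exists>\<F>. finite \<F> \<and> (\<forall>P\<in>\<F>. polytope P \<and> aff_dim P = int CARD('d) - 1) \<and> frontier \<Omega> = \<Union>\<F>)"

definition polyhedral_lipschitz_domain :: "(real^'d) set \<Rightarrow> bool" where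
  "polyhedral_lipschitz_domain \<Omega> \<longleftrightarrow>
     bounded \<Omega> \<and> lipschitz_domain \<Omega> \<and> polyhedral_boundary \<Omega>"

subsection \<open>Test functions\<close>

definition partial :: "'d \<Rightarrow> (real^'d \<Rightarrow> real) \<Rightarrow> real^'d \<Rightarrow> real" where
  "partial i f x = frechet_derivative f (at x) (axis i 1)"

definition grad :: "(real^'d \<Rightarrow> real) \<Rightarrow> real^'d \<Rightarrow> real^'d" where
  "grad f x = (\<chi> i. partial i f x)"

primrec Ck :: "nat \<Rightarrow> (real^'d \<Rightarrow> real) \<Rightarrow> bool" where
  "Ck 0 f \<longleftrightarrow> continuous_on UNIV f"
| "Ck (Suc k) f \<longleftrightarrow> (\<forall>x. f differentiable (at x)) \<and> (\<forall>i. Ck k (partial i f))"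

definition test_fun :: "(real^'d) set \<Rightarrow> (real^'d \<Rightarrow> real) set" where
  "test_fun \<Omega> = {f. (\<forall>k. Ck k f) \<and> compact (closure {x. f x \<noteq> 0}) \<and> closure {x. f x \<noteq> 0} \<subseteq> \<Omega>}"

definition zero_mean :: "(real^'d) set \<Rightarrow> (real^'d \<Rightarrow> real) \<Rightarrow> bool" where
  "zero_mean \<Omega> u \<longleftrightarrow> integrable (lebesgue_on \<Omega>) u \<and> (LINT x|lebesgue_on \<Omega>. u x) = 0"

definition test_fun0 :: "(real^'d) set \<Rightarrow> (real^'d \<Rightarrow> real) set" where
  "test_fun0 \<Omega> = {f \<in> test_fun \<Omega>. zero_mean \<Omega> f}"

subsection \<open>Weak gradients and Sobolev functions with zero boundary values\<close>

definition loc_integrable :: "(real^'d) set \<Rightarrow> (real^'d \<Rightarrow> 'b::{banach, second_countable_topology}) \<Rightarrow> bool" where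
  "loc_integrable \<Omega> u \<longleftrightarrow> (\<forall>K. compact K \<and> K \<subseteq> \<Omega> \<longrightarrow> integrable (lebesgue_on K) u)"

definition has_weak_gradient ::
    "(real^'d) set \<Rightarrow> (real^'d \<Rightarrow> real) \<Rightarrow> (real^'d \<Rightarrow> real^'d) \<Rightarrow> bool" where
  "has_weak_gradient \<Omega> u g \<longleftrightarrow> loc_integrable \<Omega> u \<and> loc_integrable \<Omega> g \<and>
     (\<forall>\<eta> \<in> test_fun \<Omega>. \<forall>i.
        (LINT x|lebesgue_on \<Omega>. u x * partial i \<eta> x) = - (LINT x|lebesgue_on \<Omega>. (g x $ i) * \<eta> x))"

text \<open>A representative of the weak gradient (unique up to null sets, if it exists).\<close>

definition weak_grad :: "(real^'d) set \<Rightarrow> (real^'d \<Rightarrow> real) \<Rightarrow> real^'d \<Rightarrow> real^'d" where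
  "weak_grad \<Omega> u = (SOME g. has_weak_gradient \<Omega> u g)"

text \<open>Row \<open>i\<close> of the weak Jacobian is the weak gradient of component \<open>i\<close>; the norm on
  \<open>real^'d^'d\<close> is the Frobenius norm.\<close>

definition weak_jac :: "(real^'d) set \<Rightarrow> (real^'d \<Rightarrow> real^'d) \<Rightarrow> real^'d \<Rightarrow> real^'d^'d" where
  "weak_jac \<Omega> v x = (\<chi> i. weak_grad \<Omega> (\<lambda>y. v y $ i) x)"

text \<open>\<open>W\<^sup>1\<^sup>,\<^sup>1\<^sub>0\<close>: the closure of the test functions in \<open>W\<^sup>1\<^sup>,\<^sup>1\<close>.\<close>

definition sobolev11_0 :: "(real^'d) set \<Rightarrow> (real^'d \<Rightarrow> real) set" where
  "sobolev11_0 \<Omega> = {u. integrable (lebesgue_on \<Omega>) u \<and>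
     (\<exists>g. has_weak_gradient \<Omega> u g \<and> integrable (lebesgue_on \<Omega>) g \<and>
       (\<exists>\<eta> :: nat \<Rightarrow> real^'d \<Rightarrow> real. (\<forall>n. \<eta> n \<in> test_fun \<Omega>) \<and>
          (\<lambda>n. LINT x|lebesgue_on \<Omega>. \<bar>\<eta> n x - u x\<bar>) \<longlonglongrightarrow> 0 \<and>
          (\<lambda>n. LINT x|lebesgue_on \<Omega>. norm (grad (\<eta> n) x - g x)) \<longlonglongrightarrow> 0))}"

subsection \<open>N-functions and Musielak-Orlicz spaces\<close>

definition phi :: "real \<Rightarrow> real \<Rightarrow> real \<Rightarrow> real" where
  "phi p \<delta> t = integral {0..t} (\<lambda>s. (\<delta> + s) powr (p - 2) * s)"

definition shifted :: "(real \<Rightarrow> real) \<Rightarrow> real \<Rightarrow> real \<Rightarrow> real" where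
  "shifted \<phi> a t = integral {0..t} (\<lambda>s. deriv \<phi> (a + s) * (s / (a + s)))"

text \<open>The same definitions serve scalar, vector and matrix fields; generalized N-functions
  \<open>\<psi>\<close> take the point as first argument.\<close>

definition modular ::
    "(real^'d) set \<Rightarrow> (real^'d \<Rightarrow> real \<Rightarrow> real) \<Rightarrow> (real^'d \<Rightarrow> 'b::real_normed_vector) \<Rightarrow> ennreal" where
  "modular \<Omega> \<psi> u = (\<integral>\<^sup>+ x. ennreal (\<psi> x (norm (u x))) \<partial>lebesgue_on \<Omega>)"

definition orlicz ::
    "(real^'d) set \<Rightarrow> (real^'d \<Rightarrow> real \<Rightarrow> real) \<Rightarrow> (real^'d \<Rightarrow> 'b::real_normed_vector) set" where
  "orlicz \<Omega> \<psi> = {u. u \<in> borel_measurable (lebesgue_on \<Omega>) \<and>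
                     (\<exists>k>0. modular \<Omega> \<psi> (\<lambda>x. k *\<^sub>R u x) < \<infinity>)}"

definition luxemburg ::
    "(real^'d) set \<Rightarrow> (real^'d \<Rightarrow> real \<Rightarrow> real) \<Rightarrow> (real^'d \<Rightarrow> 'b::real_normed_vector) \<Rightarrow> real" where
  "luxemburg \<Omega> \<psi> u = Inf {k. k > 0 \<and> modular \<Omega> \<psi> (\<lambda>x. (1 / k) *\<^sub>R u x) \<le> 1}"

definition orlicz0 :: "(real^'d) set \<Rightarrow> (real^'d \<Rightarrow> real \<Rightarrow> real) \<Rightarrow> (real^'d \<Rightarrow> real) set" where
  "orlicz0 \<Omega> \<psi> = {u \<in> orlicz \<Omega> \<psi>. zero_mean \<Omega> u}"

definition sobolev_orlicz0 :: "(real^'d) set \<Rightarrow> (real^'d \<Rightarrow> real \<Rightarrow> real) \<Rightarrow> (real^'d \<Rightarrow> real) set" where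
  "sobolev_orlicz0 \<Omega> \<psi> = {u \<in> sobolev11_0 \<Omega>. u \<in> orlicz \<Omega> \<psi> \<and> weak_grad \<Omega> u \<in> orlicz \<Omega> \<psi>}"

definition vec_space :: "(real^'d \<Rightarrow> real) set \<Rightarrow> (real^'d \<Rightarrow> real^'d) set" where
  "vec_space X = {v. \<forall>i. (\<lambda>x. v x $ i) \<in> X}"

definition sobolev_orlicz_norm ::
    "(real^'d) set \<Rightarrow> (real^'d \<Rightarrow> real \<Rightarrow> real) \<Rightarrow> (real^'d \<Rightarrow> real^'d) \<Rightarrow> real" where
  "sobolev_orlicz_norm \<Omega> \<psi> v = luxemburg \<Omega> \<psi> v + luxemburg \<Omega> \<psi> (weak_jac \<Omega> v)"

subsection \<open>Muckenhoupt weights and weighted spaces\<close>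

definition weight :: "(real^'d \<Rightarrow> real) \<Rightarrow> bool" where
  "weight \<sigma> \<longleftrightarrow> loc_integrable UNIV \<sigma> \<and> (AE x in lebesgue. 0 < \<sigma> x)"

definition ball_mean :: "(real^'d) set \<Rightarrow> (real^'d \<Rightarrow> real) \<Rightarrow> ennreal" where
  "ball_mean U f = (\<integral>\<^sup>+ x. ennreal (f x) \<partial>lebesgue_on U) / emeasure lebesgue U"

text \<open>Real powers with positive exponent on \<open>[0, \<infinity>]\<close>.\<close>

definition epowr :: "ennreal \<Rightarrow> real \<Rightarrow> ennreal" where
  "epowr x a = (if x = \<infinity> then \<infinity> else ennreal (enn2real x powr a))"

text \<open>The exponent \<open>1 - s / (s - 1)\<close> is \<open>1 - s'\<close> with the conjugate exponent \<open>s'\<close> of \<open>s\<close>.\<close>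

definition Ap_const :: "real \<Rightarrow> (real^'d \<Rightarrow> real) \<Rightarrow> ennreal" where
  "Ap_const s \<sigma> = (SUP (x, r) \<in> UNIV \<times> {0<..}.
     ball_mean (ball x r) \<sigma> * epowr (ball_mean (ball x r) (\<lambda>y. \<sigma> y powr (1 - s / (s - 1)))) (s - 1))"

definition Ap :: "real \<Rightarrow> (real^'d \<Rightarrow> real) set" where
  "Ap s = {\<sigma>. weight \<sigma> \<and> Ap_const s \<sigma> < \<infinity>}"

definition weighted_Lp ::
    "(real^'d) set \<Rightarrow> real \<Rightarrow> (real^'d \<Rightarrow> real) \<Rightarrow> (real^'d \<Rightarrow> 'b::real_normed_vector) set" where
  "weighted_Lp \<Omega> s \<sigma> = {u. u \<in> borel_measurable (lebesgue_on \<Omega>) \<and>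
                           integrable (lebesgue_on \<Omega>) (\<lambda>x. norm (u x) powr s * \<sigma> x)}"

definition weighted_norm ::
    "(real^'d) set \<Rightarrow> real \<Rightarrow> (real^'d \<Rightarrow> real) \<Rightarrow> (real^'d \<Rightarrow> 'b::real_normed_vector) \<Rightarrow> real" where
  "weighted_norm \<Omega> s \<sigma> u = (LINT x|lebesgue_on \<Omega>. norm (u x) powr s * \<sigma> x) powr (1 / s)"

definition weighted_Lp0 :: "(real^'d) set \<Rightarrow> real \<Rightarrow> (real^'d \<Rightarrow> real) \<Rightarrow> (real^'d \<Rightarrow> real) set" where
  "weighted_Lp0 \<Omega> s \<sigma> = {u \<in> weighted_Lp \<Omega> s \<sigma>. zero_mean \<Omega> u}"

definition weighted_sobolev0 :: "(real^'d) set \<Rightarrow> real \<Rightarrow> (real^'d \<Rightarrow> real) \<Rightarrow> (real^'d \<Rightarrow> real) set" where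
  "weighted_sobolev0 \<Omega> s \<sigma> =
     {u \<in> sobolev11_0 \<Omega>. u \<in> weighted_Lp \<Omega> s \<sigma> \<and> weak_grad \<Omega> u \<in> weighted_Lp \<Omega> s \<sigma>}"

definition weighted_sobolev_norm ::
    "(real^'d) set \<Rightarrow> real \<Rightarrow> (real^'d \<Rightarrow> real) \<Rightarrow> (real^'d \<Rightarrow> real^'d) \<Rightarrow> real" where
  "weighted_sobolev_norm \<Omega> s \<sigma> v = weighted_norm \<Omega> s \<sigma> v + weighted_norm \<Omega> s \<sigma> (weak_jac \<Omega> v)"

subsection \<open>Continuous extensions of operators on test functions\<close>

text \<open>\<open>T\<close> induces a continuous linear operator from \<open>X\<close> with norm \<open>NX\<close> to \<open>Y\<close> with norm \<open>NY\<close>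
  (both modulo equality almost everywhere on \<open>\<Omega>\<close>) which agrees with \<open>B\<close> on the test functions
  with zero mean.\<close>

definition continuous_extension ::
    "(real^'d) set \<Rightarrow> ((real^'d \<Rightarrow> real) \<Rightarrow> real^'d \<Rightarrow> real^'d) \<Rightarrow>
     (real^'d \<Rightarrow> real) set \<Rightarrow> ((real^'d \<Rightarrow> real) \<Rightarrow> real) \<Rightarrow>
     (real^'d \<Rightarrow> real^'d) set \<Rightarrow> ((real^'d \<Rightarrow> real^'d) \<Rightarrow> real) \<Rightarrow>
     ((real^'d \<Rightarrow> real) \<Rightarrow> real^'d \<Rightarrow> real^'d) \<Rightarrow> bool" where
  "continuous_extension \<Omega> B X NX Y NY T \<longleftrightarrow>
     (\<forall>z\<in>X. T z \<in> Y) \<and>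
     (\<forall>z\<in>X. \<forall>w\<in>X. (AE x in lebesgue_on \<Omega>. z x = w x) \<longrightarrow> (AE x in lebesgue_on \<Omega>. T z x = T w x)) \<and>
     (\<forall>z\<in>X. \<forall>w\<in>X. \<forall>a b. AE x in lebesgue_on \<Omega>.
        T (\<lambda>y. a * z y + b * w y) x = a *\<^sub>R T z x + b *\<^sub>R T w x) \<and>
     (\<forall>z\<in>X. \<forall>\<epsilon>>0. \<exists>\<eta>>0. \<forall>w\<in>X. NX (\<lambda>x. w x - z x) < \<eta> \<longrightarrow> NY (\<lambda>x. T w x - T z x) < \<epsilon>) \<and>
     test_fun0 \<Omega> \<subseteq> X \<and>
     (\<forall>z \<in> test_fun0 \<Omega>. AE x in lebesgue_on \<Omega>. T z x = B z x)"

definition unique_continuous_extension ::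
    "(real^'d) set \<Rightarrow> ((real^'d \<Rightarrow> real) \<Rightarrow> real^'d \<Rightarrow> real^'d) \<Rightarrow>
     (real^'d \<Rightarrow> real) set \<Rightarrow> ((real^'d \<Rightarrow> real) \<Rightarrow> real) \<Rightarrow>
     (real^'d \<Rightarrow> real^'d) set \<Rightarrow> ((real^'d \<Rightarrow> real^'d) \<Rightarrow> real) \<Rightarrow>
     ((real^'d \<Rightarrow> real) \<Rightarrow> real^'d \<Rightarrow> real^'d) \<Rightarrow> bool" where
  "unique_continuous_extension \<Omega> B X NX Y NY T \<longleftrightarrow>
     continuous_extension \<Omega> B X NX Y NY T \<and>
     (\<forall>T'. continuous_extension \<Omega> B X NX Y NY T' \<longrightarrow>
        (\<forall>z\<in>X. AE x in lebesgue_on \<Omega>. T' z x = T z x))"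

subsection \<open>The Bogovskii operator\<close>

text \<open>The Bogovskii operator enters only through the properties recorded here. The constant in
  the weighted estimate is a function \<open>C\<close> of the Muckenhoupt constant that is fixed before the
  weight.\<close>

definition bogovskii_operator ::
    "(real^'d) set \<Rightarrow> ((real^'d \<Rightarrow> real) \<Rightarrow> real^'d \<Rightarrow> real^'d) \<Rightarrow> bool" where
  "bogovskii_operator \<Omega> B \<longleftrightarrow>
     (\<forall>z \<in> test_fun0 \<Omega>. B z \<in> vec_space (test_fun \<Omega>)) \<and>
     (\<forall>z \<in> test_fun0 \<Omega>. \<forall>w \<in> test_fun0 \<Omega>. \<forall>a b.
        B (\<lambda>y. a * z y + b * w y) = (\<lambda>x. a *\<^sub>R B z x + b *\<^sub>R B w x)) \<and>
     (\<forall>z \<in> test_fun0 \<Omega>. \<forall>x. (\<Sum>i\<in>UNIV. partial i (\<lambda>y. B z y $ i) x) = z x) \<and>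
     (\<forall>s>1. \<exists>C :: ennreal \<Rightarrow> real. \<forall>\<sigma> \<in> Ap s. \<exists>T.
        unique_continuous_extension \<Omega> B
          (weighted_Lp0 \<Omega> s \<sigma>) (weighted_norm \<Omega> s \<sigma>)
          (vec_space (weighted_sobolev0 \<Omega> s \<sigma>)) (weighted_sobolev_norm \<Omega> s \<sigma>) T \<and>
        (\<forall>z \<in> weighted_Lp0 \<Omega> s \<sigma>.
           weighted_norm \<Omega> s \<sigma> (weak_jac \<Omega> (T z)) \<le> C (Ap_const s \<sigma>) * weighted_norm \<Omega> s \<sigma> z))"

subsection \<open>The weight and the N-function of a matrix field\<close>

definition zero_ext :: "(real^'d) set \<Rightarrow> (real^'d \<Rightarrow> 'b::zero) \<Rightarrow> real^'d \<Rightarrow> 'b" where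
  "zero_ext \<Omega> A x = (if x \<in> \<Omega> then A x else 0)"

text \<open>The case distinction implements \<open>0\<^sup>0 = 1\<close>, whereas \<open>0 powr 0 = 0\<close>.\<close>

definition mu_weight ::
    "(real^'d) set \<Rightarrow> real \<Rightarrow> real \<Rightarrow> (real^'d \<Rightarrow> real^'d^'d) \<Rightarrow> real^'d \<Rightarrow> real" where
  "mu_weight \<Omega> p \<delta> A x = (if p = 2 then 1 else (\<delta> + norm (zero_ext \<Omega> A x)) powr (p - 2))"

definition phi_shift :: "real \<Rightarrow> real \<Rightarrow> (real^'d \<Rightarrow> real^'d^'d) \<Rightarrow> real^'d \<Rightarrow> real \<Rightarrow> real" where
  "phi_shift p \<delta> A x t = shifted (phi p \<delta>) (norm (A x)) t"

end

theory Submission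
  imports Defs
begin

text \<open>The shifted N-function grows like \<open>\<phi>\<^sub>a(t) \<approx> (\<delta> + a)\<^sup>p\<^sup>-\<^sup>2 t\<^sup>2 + t\<^sup>p\<close> with constants depending on
  \<open>p\<close> only (\<open>shifted_phi_lower\<close>, \<open>shifted_phi_upper\<close>).  Hence the modular of \<open>u\<close> is comparable to the sum
  of the energies \<open>\<integral> \<bar>u\<bar>\<^sup>2 \<mu>\<close>, where \<open>\<mu>\<close> is the weight of \<open>A\<close>, and \<open>\<integral> \<bar>u\<bar>\<^sup>p\<close>.  The modular estimate is the sum
  of two weighted estimates for the Bogovskii operator, one with exponent \<open>2\<close> and weight \<open>\<mu>\<close>, the
  other with exponent \<open>p\<close> and weight \<open>1\<close>, provided that both concern the same extension.

  The bound \<open>(\<delta> + \<bar>A\<bar>)\<^sup>p\<^sup>-\<^sup>2 t\<^sup>2 \<le> (\<delta> + \<bar>A\<bar>)\<^sup>p + t\<^sup>p\<close> and the \<open>p\<close>-integrability of \<open>A\<close> show that the second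
  energy controls the first (\<open>weighted_Lp_subset_mu\<close>).  So the Orlicz space is \<open>L\<^sup>p\<close> as a set, and the
  Luxemburg norm and the \<open>L\<^sup>p\<close> norm define the same convergence to \<open>0\<close>; the constants involved depend
  on \<open>A\<close>, which does no harm to continuity.  Therefore the unique continuous extension
  \<open>T\<close> to \<open>L\<^sup>p\<close> is also the unique continuous extension to the Orlicz space.

  It remains to see that \<open>T\<close> agrees on \<open>L\<^sup>p\<close> with the extension \<open>T\<^sub>\<mu>\<close> to the weighted \<open>L\<^sup>2\<close> space
  (\<open>weighted_extensions_agree\<close>).  This follows from the uniqueness of the extensions.  If a continuous functional \<open>F z = \<integral> h \<bullet> (T\<^sub>\<mu> z - T z)\<close>
  were nonzero, then \<open>z \<mapsto> T (z + F z * z1)\<close>, with \<open>T z1 \<noteq> 0\<close>, would be another extension to \<open>L\<^sup>p\<close>, since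
  \<open>F\<close> vanishes on test functions; and if \<open>T = 0\<close>, then \<open>z \<mapsto> T\<^sub>\<mu> (2 * z)\<close> is another extension to
  the weighted space unless \<open>T\<^sub>\<mu> = 0\<close>.\<close>

section \<open>Null sets and weak derivatives\<close>
lemma borel_measurable_lebesgue_on_cong_AE:
  fixes f g :: "'a::euclidean_space \<Rightarrow> 'b::euclidean_space"
  assumes S: "S \<in> sets lebesgue" and ae: "AE x in lebesgue_on S. f x = g x"
    and f: "f \<in> borel_measurable (lebesgue_on S)"
  shows "g \<in> borel_measurable (lebesgue_on S)"
proof -
  have "(\<lambda>x. indicator S x *\<^sub>R f x) \<in> borel_measurable lebesgue"
    using f S by (subst (asm) borel_measurable_restrict_space_iff) auto
  moreover have "AE x in lebesgue. indicator S x *\<^sub>R f x = indicator S x *\<^sub>R g x"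
    using ae S by (subst (asm) AE_restrict_space_iff) (auto simp: indicator_def elim: eventually_mono)
  ultimately have "(\<lambda>x. indicator S x *\<^sub>R g x) \<in> borel_measurable lebesgue"
    by (rule borel_measurable_AE)
  then show ?thesis
    using S by (subst borel_measurable_restrict_space_iff) auto
qed

lemma integrable_lebesgue_on_cong_AE:
  fixes f g :: "'a::euclidean_space \<Rightarrow> 'b::euclidean_space"
  assumes S: "S \<in> sets lebesgue" and ae: "AE x in lebesgue_on S. f x = g x"
  shows "integrable (lebesgue_on S) f \<longleftrightarrow> integrable (lebesgue_on S) g"
proof -
  have ae': "AE x in lebesgue_on S. g x = f x"
    using ae by (auto elim: eventually_mono)
  show ?thesis
    using integrable_cong_AE_imp borel_measurable_lebesgue_on_cong_AE[OF S ae]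
      borel_measurable_lebesgue_on_cong_AE[OF S ae'] ae ae'
    by (metis borel_measurable_integrable)
qed

text \<open>If one side fails to be integrable, so does the other, and both integrals have the default
  value \<open>0\<close>.  Hence norms that are defined by integrals respect equality almost everywhere for
  arbitrary functions.\<close>
lemma integral_lebesgue_on_cong_AE:
  fixes f g :: "'a::euclidean_space \<Rightarrow> 'b::euclidean_space"
  assumes S: "S \<in> sets lebesgue" and ae: "AE x in lebesgue_on S. f x = g x"
  shows "integral\<^sup>L (lebesgue_on S) f = integral\<^sup>L (lebesgue_on S) g"
proof (cases "integrable (lebesgue_on S) f")
  case True
  then have "integrable (lebesgue_on S) g"
    using integrable_lebesgue_on_cong_AE[OF assms] by simp
  with True ae show ?thesis
    by (intro integral_cong_AE) auto
next
  case False
  then show ?thesis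
    using integrable_lebesgue_on_cong_AE[OF assms] by (simp add: not_integrable_integral_eq)
qed

lemma AE_lebesgue_on_subset:
  assumes "AE x in lebesgue_on S. P x" "K \<subseteq> S" "S \<in> sets lebesgue" "K \<in> sets lebesgue"
  shows "AE x in lebesgue_on K. P x"
  using assms by (auto simp: AE_restrict_space_iff elim!: eventually_mono)

lemma loc_integrable_cong_AE:
  fixes u v :: "real^'d \<Rightarrow> 'b::euclidean_space"
  assumes "\<Omega> \<in> sets lebesgue" "AE x in lebesgue_on \<Omega>. u x = v x"
  shows "loc_integrable \<Omega> u \<longleftrightarrow> loc_integrable \<Omega> v"
proof -
  have "integrable (lebesgue_on K) u \<longleftrightarrow> integrable (lebesgue_on K) v" if K: "compact K" "K \<subseteq> \<Omega>" for K
  proof (rule integrable_lebesgue_on_cong_AE)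
    show K': "K \<in> sets lebesgue"
      using K by (simp add: borel_compact)
    show "AE x in lebesgue_on K. u x = v x"
      using assms K K' by (blast intro: AE_lebesgue_on_subset)
  qed
  then show ?thesis
    by (auto simp: loc_integrable_def)
qed

text \<open>The two gradients are equal as functions, not only almost everywhere: \<open>u\<close> and \<open>v\<close> have the
  same weak gradients, so the choice operator picks the same one.  Consequently the values of two
  extensions of an operator, which agree only almost everywhere, have one and the same weak Jacobian.\<close>
lemma weak_grad_cong_AE:
  assumes \<Omega>: "\<Omega> \<in> sets lebesgue" and ae: "AE x in lebesgue_on \<Omega>. u x = v x"
  shows "weak_grad \<Omega> u = weak_grad \<Omega> v"
proof -
  have "(LINT x|lebesgue_on \<Omega>. u x * partial i \<eta> x) = (LINT x|lebesgue_on \<Omega>. v x * partial i \<eta> x)"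
    for i \<eta>
    using ae by (intro integral_lebesgue_on_cong_AE[OF \<Omega>]) (auto elim!: eventually_mono)
  then show ?thesis
    by (simp add: weak_grad_def has_weak_gradient_def loc_integrable_cong_AE[OF \<Omega> ae])
qed

lemma weak_jac_cong_AE:
  assumes "\<Omega> \<in> sets lebesgue" and ae: "AE x in lebesgue_on \<Omega>. v x = w x"
  shows "weak_jac \<Omega> v = weak_jac \<Omega> w"
proof -
  have "weak_grad \<Omega> (\<lambda>y. v y $ i) = weak_grad \<Omega> (\<lambda>y. w y $ i)" for i
    using ae by (intro weak_grad_cong_AE[OF assms(1)]) (auto elim!: eventually_mono)
  then show ?thesis
    by (simp add: weak_jac_def fun_eq_iff)
qed

lemma weighted_norm_cong_AE:
  assumes "\<Omega> \<in> sets lebesgue" and ae: "AE x in lebesgue_on \<Omega>. v x = w x"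
  shows "weighted_norm \<Omega> s \<sigma> v = weighted_norm \<Omega> s \<sigma> w"
  unfolding weighted_norm_def using ae
  by (intro arg_cong[where f="\<lambda>t. t powr _"] integral_lebesgue_on_cong_AE[OF assms(1)])
    (auto elim!: eventually_mono)

lemma luxemburg_cong_AE:
  assumes ae: "AE x in lebesgue_on \<Omega>. v x = w x"
  shows "luxemburg \<Omega> \<psi> v = luxemburg \<Omega> \<psi> w"
proof -
  have "modular \<Omega> \<psi> (\<lambda>x. k *\<^sub>R v x) = modular \<Omega> \<psi> (\<lambda>x. k *\<^sub>R w x)" for k
    unfolding modular_def using ae by (intro nn_integral_cong_AE) (auto elim!: eventually_mono)
  then show ?thesis
    by (simp add: luxemburg_def)
qed

lemma weighted_sobolev_norm_cong_AE:
  assumes "\<Omega> \<in> sets lebesgue" "AE x in lebesgue_on \<Omega>. v x = w x"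
  shows "weighted_sobolev_norm \<Omega> s \<sigma> v = weighted_sobolev_norm \<Omega> s \<sigma> w"
  using assms weak_jac_cong_AE weighted_norm_cong_AE
  unfolding weighted_sobolev_norm_def by metis

lemma sobolev_orlicz_norm_cong_AE:
  assumes "\<Omega> \<in> sets lebesgue" "AE x in lebesgue_on \<Omega>. v x = w x"
  shows "sobolev_orlicz_norm \<Omega> \<psi> v = sobolev_orlicz_norm \<Omega> \<psi> w"
  using assms weak_jac_cong_AE luxemburg_cong_AE
  unfolding sobolev_orlicz_norm_def by metis

section \<open>Continuous extensions and changes of the norm\<close>

text \<open>The defining clauses of \<open>continuous_extension\<close> that do not mention norms; they survive every
  change of the norms.\<close>
definition linear_extension ::
    "(real^'d) set \<Rightarrow> ((real^'d \<Rightarrow> real) \<Rightarrow> real^'d \<Rightarrow> real^'d) \<Rightarrow> (real^'d \<Rightarrow> real) set \<Rightarrow>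
     (real^'d \<Rightarrow> real^'d) set \<Rightarrow> ((real^'d \<Rightarrow> real) \<Rightarrow> real^'d \<Rightarrow> real^'d) \<Rightarrow> bool" where
  "linear_extension \<Omega> B X Y T \<longleftrightarrow>
     (\<forall>z\<in>X. T z \<in> Y) \<and>
     (\<forall>z\<in>X. \<forall>w\<in>X. (AE x in lebesgue_on \<Omega>. z x = w x) \<longrightarrow> (AE x in lebesgue_on \<Omega>. T z x = T w x)) \<and>
     (\<forall>z\<in>X. \<forall>w\<in>X. \<forall>a b. AE x in lebesgue_on \<Omega>.
        T (\<lambda>y. a * z y + b * w y) x = a *\<^sub>R T z x + b *\<^sub>R T w x) \<and>
     test_fun0 \<Omega> \<subseteq> X \<and>
     (\<forall>z \<in> test_fun0 \<Omega>. AE x in lebesgue_on \<Omega>. T z x = B z x)"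

text \<open>For linear maps this is continuity (see \<open>continuous_extension_iff_continuous_at_zero\<close>).  All
  comparisons of norms are made in this form, because the energies with exponents \<open>2\<close> and \<open>p\<close> scale
  differently and the bounds between them are not homogeneous.\<close>
definition continuous_at_zero :: "'a set \<Rightarrow> ('a \<Rightarrow> real) \<Rightarrow> ('b \<Rightarrow> real) \<Rightarrow> ('a \<Rightarrow> 'b) \<Rightarrow> bool" where
  "continuous_at_zero X NX NY T \<longleftrightarrow> (\<forall>\<epsilon>>0. \<exists>\<eta>>0. \<forall>u\<in>X. NX u < \<eta> \<longrightarrow> NY (T u) < \<epsilon>)"

definition linear_closed :: "('a \<Rightarrow> real) set \<Rightarrow> bool" where
  "linear_closed X \<longleftrightarrow> (\<lambda>_. 0) \<in> X \<and> (\<forall>z\<in>X. \<forall>w\<in>X. \<forall>a b. (\<lambda>y. a * z y + b * w y) \<in> X)"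

lemma linear_extension_diff:
  assumes T: "linear_extension \<Omega> B X Y T" and "z \<in> X" "w \<in> X"
  shows "AE x in lebesgue_on \<Omega>. T (\<lambda>y. w y - z y) x = T w x - T z x"
proof -
  have "AE x in lebesgue_on \<Omega>. T (\<lambda>y. 1 * w y + (-1) * z y) x = 1 *\<^sub>R T w x + (-1) *\<^sub>R T z x"
    using assms unfolding linear_extension_def by blast
  then show ?thesis
    by simp
qed

text \<open>\<open>T w - T z\<close> agrees almost everywhere with \<open>T (w - z)\<close>, and the norm on the target does not
  see null sets.\<close>
lemma continuous_extension_iff_continuous_at_zero:
  assumes X: "linear_closed X"
    and cong: "\<And>u v. (AE x in lebesgue_on \<Omega>. u x = v x) \<Longrightarrow> NY u = NY v"
  shows "continuous_extension \<Omega> B X NX Y NY T \<longleftrightarrow>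
    linear_extension \<Omega> B X Y T \<and> continuous_at_zero X NX NY T" (is "?L \<longleftrightarrow> ?R")
proof -
  have diff: "NY (\<lambda>x. T w x - T z x) = NY (T (\<lambda>y. w y - z y))"
    if "linear_extension \<Omega> B X Y T" "z \<in> X" "w \<in> X" for z w
    using linear_extension_diff[OF that] cong by metis
  have X_diff: "(\<lambda>y. w y - z y) \<in> X" if "z \<in> X" "w \<in> X" for z w
  proof -
    have "(\<lambda>y. 1 * w y + (-1) * z y) \<in> X"
      using X that unfolding linear_closed_def by blast
    then show ?thesis by simp
  qed
  have zero: "(\<lambda>_. 0) \<in> X"
    using X by (simp add: linear_closed_def)
  show ?thesis
  proof
    assume L: ?L
    then have lin: "linear_extension \<Omega> B X Y T"
      unfolding continuous_extension_def linear_extension_def by blast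
    have cont: "\<forall>z\<in>X. \<forall>\<epsilon>>0. \<exists>\<eta>>0. \<forall>w\<in>X. NX (\<lambda>x. w x - z x) < \<eta> \<longrightarrow> NY (\<lambda>x. T w x - T z x) < \<epsilon>"
      using L unfolding continuous_extension_def by blast
    have "continuous_at_zero X NX NY T"
      unfolding continuous_at_zero_def
      using bspec[OF cont zero] diff[OF lin zero] by simp
    with lin show ?R ..
  next
    assume R: ?R
    then have lin: "linear_extension \<Omega> B X Y T" ..
    have "\<forall>z\<in>X. \<forall>\<epsilon>>0. \<exists>\<eta>>0. \<forall>w\<in>X. NX (\<lambda>x. w x - z x) < \<eta> \<longrightarrow> NY (\<lambda>x. T w x - T z x) < \<epsilon>"
    proof (intro ballI allI impI)
      fix z and \<epsilon> :: real assume "z \<in> X" "\<epsilon> > 0"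
      then obtain \<eta> where "\<eta> > 0" "\<forall>u\<in>X. NX u < \<eta> \<longrightarrow> NY (T u) < \<epsilon>"
        using R unfolding continuous_at_zero_def by blast
      then show "\<exists>\<eta>>0. \<forall>w\<in>X. NX (\<lambda>x. w x - z x) < \<eta> \<longrightarrow> NY (\<lambda>x. T w x - T z x) < \<epsilon>"
        using diff[OF lin \<open>z \<in> X\<close>] X_diff[OF \<open>z \<in> X\<close>] by auto
    qed
    with lin show ?L
      unfolding continuous_extension_def linear_extension_def by blast
  qed
qed

text \<open>\<open>N'\<close> defines a coarser topology than \<open>N\<close> near \<open>0\<close>.\<close>
definition norm_dominates :: "'a set \<Rightarrow> ('a \<Rightarrow> real) \<Rightarrow> ('a \<Rightarrow> real) \<Rightarrow> bool" where
  "norm_dominates X N N' \<longleftrightarrow> continuous_at_zero X N N' (\<lambda>u. u)"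

lemma continuous_at_zero_comp:
  assumes "continuous_at_zero X N M S" "continuous_at_zero Z M P T" "S ` X \<subseteq> Z"
  shows "continuous_at_zero X N P (\<lambda>u. T (S u))"
  unfolding continuous_at_zero_def
proof (intro allI impI)
  fix \<epsilon> :: real assume "\<epsilon> > 0"
  then obtain \<theta> where \<theta>: "\<theta> > 0" "\<forall>u\<in>Z. M u < \<theta> \<longrightarrow> P (T u) < \<epsilon>"
    using assms(2) unfolding continuous_at_zero_def by blast
  then obtain \<eta> where \<eta>: "\<eta> > 0" "\<forall>u\<in>X. N u < \<eta> \<longrightarrow> M (S u) < \<theta>"
    using assms(1) unfolding continuous_at_zero_def by blast
  then show "\<exists>\<eta>>0. \<forall>u\<in>X. N u < \<eta> \<longrightarrow> P (T (S u)) < \<epsilon>"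
    using \<theta> assms(3) by (intro exI[of _ \<eta>]) auto
qed

lemma continuous_extension_change_norms:
  assumes X: "linear_closed X"
    and cong: "\<And>u v. (AE x in lebesgue_on \<Omega>. u x = v x) \<Longrightarrow> NY u = NY v"
    and cong': "\<And>u v. (AE x in lebesgue_on \<Omega>. u x = v x) \<Longrightarrow> NY' u = NY' v"
    and NX: "norm_dominates X NX' NX" and NY: "norm_dominates Y NY NY'"
    and T: "continuous_extension \<Omega> B X NX Y NY T"
  shows "continuous_extension \<Omega> B X NX' Y NY' T"
proof -
  have lin: "linear_extension \<Omega> B X Y T" and cont: "continuous_at_zero X NX NY T"
    using T continuous_extension_iff_continuous_at_zero[where NY=NY, OF X cong] by blast+
  have TY: "T ` X \<subseteq> Y"
    using lin unfolding linear_extension_def by blast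
  have "continuous_at_zero X NX' NY' (\<lambda>u. T u)"
    using continuous_at_zero_comp[OF _ continuous_at_zero_comp[OF cont _ TY], of X NX' "\<lambda>u. u" NY' "\<lambda>u. u"]
      NX NY by (simp add: norm_dominates_def)
  with lin show ?thesis
    using continuous_extension_iff_continuous_at_zero[where NY=NY', OF X cong'] by blast
qed

lemma unique_continuous_extension_change_norms:
  assumes X: "linear_closed X"
    and cong: "\<And>u v. (AE x in lebesgue_on \<Omega>. u x = v x) \<Longrightarrow> NY u = NY v"
    and cong': "\<And>u v. (AE x in lebesgue_on \<Omega>. u x = v x) \<Longrightarrow> NY' u = NY' v"
    and NX: "norm_dominates X NX NX'" "norm_dominates X NX' NX"
    and NY: "norm_dominates Y NY NY'" "norm_dominates Y NY' NY"
    and T: "unique_continuous_extension \<Omega> B X NX Y NY T"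
  shows "unique_continuous_extension \<Omega> B X NX' Y NY' T"
  using T continuous_extension_change_norms[OF X cong cong' NX(2) NY(1)]
    continuous_extension_change_norms[OF X cong' cong NX(1) NY(2)]
  unfolding unique_continuous_extension_def by blast

text \<open>The form in which uniqueness is exploited: if precomposition with a continuous linear \<open>S\<close> does not
  change the values of \<open>T\<close> on test functions, then \<open>T \<circ> S\<close> is a second extension, so \<open>S\<close> does not
  change the values of \<open>T\<close> anywhere.\<close>
lemma unique_continuous_extension_comp:
  assumes X: "linear_closed X"
    and cong: "\<And>u v. (AE x in lebesgue_on \<Omega>. u x = v x) \<Longrightarrow> NY u = NY v"
    and T: "unique_continuous_extension \<Omega> B X NX Y NY T"
    and SX: "S ` X \<subseteq> X"
    and S_cong: "\<And>z w. z \<in> X \<Longrightarrow> w \<in> X \<Longrightarrow> AE x in lebesgue_on \<Omega>. z x = w x \<Longrightarrow>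
      AE x in lebesgue_on \<Omega>. S z x = S w x"
    and S_lin: "\<And>z w a b. z \<in> X \<Longrightarrow> w \<in> X \<Longrightarrow>
      S (\<lambda>y. a * z y + b * w y) = (\<lambda>y. a * S z y + b * S w y)"
    and S_cont: "continuous_at_zero X NX NX S"
    and S_test: "\<And>z. z \<in> test_fun0 \<Omega> \<Longrightarrow> AE x in lebesgue_on \<Omega>. T (S z) x = B z x"
    and z: "z \<in> X"
  shows "AE x in lebesgue_on \<Omega>. T (S z) x = T z x"
proof -
  have lin: "linear_extension \<Omega> B X Y T" and cont: "continuous_at_zero X NX NY T"
    using T continuous_extension_iff_continuous_at_zero[where NY=NY, OF X cong]
    unfolding unique_continuous_extension_def by blast+
  have "linear_extension \<Omega> B X Y (\<lambda>z. T (S z))"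
    unfolding linear_extension_def
  proof (intro conjI ballI allI impI)
    show "test_fun0 \<Omega> \<subseteq> X"
      using lin unfolding linear_extension_def by blast
    fix z assume z: "z \<in> X"
    then show "T (S z) \<in> Y"
      using lin SX unfolding linear_extension_def by blast
    fix w assume w: "w \<in> X"
    show "AE x in lebesgue_on \<Omega>. T (S (\<lambda>y. a * z y + b * w y)) x = a *\<^sub>R T (S z) x + b *\<^sub>R T (S w) x" for a b
      unfolding S_lin[OF z w] using lin SX z w unfolding linear_extension_def by blast
    assume "AE x in lebesgue_on \<Omega>. z x = w x"
    then show "AE x in lebesgue_on \<Omega>. T (S z) x = T (S w) x"
      using S_cong[OF z w] lin SX z w unfolding linear_extension_def by blast
  qed (rule S_test)
  moreover have "continuous_at_zero X NX NY (\<lambda>u. T (S u))"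
    by (rule continuous_at_zero_comp[OF S_cont cont SX])
  ultimately have "continuous_extension \<Omega> B X NX Y NY (\<lambda>z. T (S z))"
    using continuous_extension_iff_continuous_at_zero[where NY=NY, OF X cong] by blast
  with T z show ?thesis
    unfolding unique_continuous_extension_def by blast
qed

section \<open>Growth of the shifted N-functions\<close>

text \<open>At \<open>s = 0\<close> the factor \<open>s\<close> repairs the value \<open>0 powr 0 = 0\<close>, which would otherwise break
  continuity for \<open>p = 2\<close>, \<open>b = 0\<close>.\<close>
lemma continuous_on_phi_integrand:
  assumes "p \<ge> 2" "b \<ge> 0"
  shows "continuous_on {0..} (\<lambda>s::real. (b + s) powr (p - 2) * s)"
proof (cases "p = 2")
  case True
  have "continuous_on {0..} (\<lambda>s::real. s)"
    by (intro continuous_intros)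
  then show ?thesis
    by (rule continuous_on_eq) (use True assms in auto)
next
  case False
  then show ?thesis
    using assms by (intro continuous_intros continuous_on_powr') auto
qed

lemma deriv_phi:
  assumes "p \<ge> 2" "\<delta> \<ge> 0" "t > 0"
  shows "deriv (phi p \<delta>) t = (\<delta> + t) powr (p - 2) * t"
proof -
  have "continuous_on {0..t+1} (\<lambda>s. (\<delta> + s) powr (p - 2) * s)"
    by (rule continuous_on_subset[OF continuous_on_phi_integrand[OF assms(1,2)]]) auto
  then have "(phi p \<delta> has_real_derivative (\<delta> + t) powr (p - 2) * t) (at t within {0..t+1})"
    unfolding phi_def using assms(3) by (intro integral_has_real_derivative) auto
  moreover have "at t within {0..t+1} = at t"
    using assms(3) by (intro at_within_interior) auto
  ultimately show ?thesis
    by (simp add: DERIV_imp_deriv)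
qed

lemma shifted_phi_eq:
  assumes "p \<ge> 2" "\<delta> \<ge> 0" "a \<ge> 0"
  shows "shifted (phi p \<delta>) a t = integral {0..t} (\<lambda>s. (\<delta> + a + s) powr (p - 2) * s)"
  unfolding shifted_def
proof (rule integral_cong)
  fix s assume s: "s \<in> {0..t}"
  show "deriv (phi p \<delta>) (a + s) * (s / (a + s)) = (\<delta> + a + s) powr (p - 2) * s"
    using assms s by (cases "s = 0") (auto simp: deriv_phi add.assoc)
qed

lemma powr_add_le:
  fixes x y :: real
  assumes "x \<ge> 0" "y \<ge> 0" "s \<ge> 0"
  shows "(x + y) powr s \<le> 2 powr s * (x powr s + y powr s)"
proof -
  have "(x + y) powr s \<le> (2 * max x y) powr s"
    using assms by (intro powr_mono2) auto
  also have "\<dots> = 2 powr s * max x y powr s"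
    using assms by (simp add: powr_mult)
  also have "max x y powr s \<le> x powr s + y powr s"
    by (auto simp: max_def)
  finally show ?thesis
    by simp
qed

text \<open>The coefficient of \<open>t\<^sup>2\<close> in the growth of the N-function shifted by \<open>a\<close>, where \<open>b = \<delta> + a\<close>; the
  case \<open>p = 2\<close> implements \<open>0\<^sup>0 = 1\<close>, as in the weight \<open>mu_weight\<close>.\<close>
definition shift_weight :: "real \<Rightarrow> real \<Rightarrow> real" where
  "shift_weight p b = (if p = 2 then 1 else b powr (p - 2))"

text \<open>For \<open>s > 0\<close> the factor \<open>(b + s) powr (p - 2)\<close> of the integrand dominates both \<open>shift_weight p b\<close> and
  \<open>s powr (p - 2)\<close>, because \<open>p \<ge> 2\<close>; averaging the two resulting bounds and integrating gives the
  claim.\<close>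
lemma shifted_phi_lower:
  assumes "p \<ge> 2" "\<delta> \<ge> 0" "a \<ge> 0" "t \<ge> 0"
  shows "shift_weight p (\<delta> + a) * t powr 2 + t powr p \<le> 2 * p * shifted (phi p \<delta>) a t"
proof -
  let ?b = "\<delta> + a" and ?m = "shift_weight p (\<delta> + a)"
  have 1: "((\<lambda>s. ?m * s + s powr (p - 1)) has_integral (?m * (t\<^sup>2 / 2) + t powr p / p)) {0..t}"
    using has_integral_add[OF has_integral_mult_right[OF ident_has_integral[of 0 t], of ?m]
        has_integral_powr_from_0[of "p - 1" t]] assms by simp
  have 2: "((\<lambda>s. 2 * ((?b + s) powr (p - 2) * s)) has_integral
      (2 * integral {0..t} (\<lambda>s. (?b + s) powr (p - 2) * s))) {0..t}"
    using assms by (intro has_integral_mult_right integrable_integral integrable_continuous_real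
        continuous_on_subset[OF continuous_on_phi_integrand]) auto
  have "?m * (t\<^sup>2 / 2) + t powr p / p \<le> 2 * integral {0..t} (\<lambda>s. (?b + s) powr (p - 2) * s)"
  proof (rule has_integral_le[OF 1 2])
    fix s assume s: "s \<in> {0..t}"
    show "?m * s + s powr (p - 1) \<le> 2 * ((?b + s) powr (p - 2) * s)"
    proof (cases "s = 0")
      case False
      with s have "s > 0" by simp
      have "?m \<le> (?b + s) powr (p - 2)"
        using assms \<open>s > 0\<close> by (auto simp: shift_weight_def intro!: powr_mono2)
      moreover have "s powr (p - 1) = s powr (p - 2) * s"
        using \<open>s > 0\<close> powr_add[of s "p - 2" 1] by simp
      moreover have "s powr (p - 2) \<le> (?b + s) powr (p - 2)"
        using assms \<open>s > 0\<close> by (intro powr_mono2) auto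
      ultimately have "?m * s + s powr (p - 1) \<le> (?b + s) powr (p - 2) * s + (?b + s) powr (p - 2) * s"
        using \<open>s > 0\<close> by (intro add_mono) auto
      then show ?thesis by linarith
    qed auto
  qed
  then have "?m * (t\<^sup>2 / 2) + t powr p / p \<le> 2 * shifted (phi p \<delta>) a t"
    using assms by (simp add: shifted_phi_eq)
  then have "p * (?m * (t\<^sup>2 / 2) + t powr p / p) \<le> p * (2 * shifted (phi p \<delta>) a t)"
    using assms by (intro mult_left_mono) auto
  moreover have "p * (?m * (t\<^sup>2 / 2) + t powr p / p) = p / 2 * (?m * t\<^sup>2) + t powr p"
    using assms by (simp add: field_simps)
  moreover have "1 * (?m * t\<^sup>2) \<le> p / 2 * (?m * t\<^sup>2)"
    using assms by (intro mult_right_mono) (auto simp: shift_weight_def)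
  moreover have "t powr 2 = t\<^sup>2"
    using assms by simp
  moreover have "p * (2 * shifted (phi p \<delta>) a t) = 2 * p * shifted (phi p \<delta>) a t"
    by simp
  ultimately show ?thesis
    by (simp only: mult_1)
qed

lemma shifted_phi_upper:
  assumes "p \<ge> 2" "\<delta> \<ge> 0" "a \<ge> 0" "t \<ge> 0"
  shows "shifted (phi p \<delta>) a t \<le> 2 powr p * (shift_weight p (\<delta> + a) * t powr 2 + t powr p)"
proof -
  let ?b = "\<delta> + a" and ?m = "shift_weight p (\<delta> + a)"
  let ?c = "2 powr (p - 2) * (?m + t powr (p - 2))"
  have 1: "((\<lambda>s. ?c * s) has_integral (?c * (t\<^sup>2 / 2))) {0..t}"
    using has_integral_mult_right[OF ident_has_integral[of 0 t], of ?c] assms by simp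
  have 2: "((\<lambda>s. (?b + s) powr (p - 2) * s) has_integral
      (integral {0..t} (\<lambda>s. (?b + s) powr (p - 2) * s))) {0..t}"
    using assms by (intro integrable_integral integrable_continuous_real
        continuous_on_subset[OF continuous_on_phi_integrand]) auto
  have "integral {0..t} (\<lambda>s. (?b + s) powr (p - 2) * s) \<le> ?c * (t\<^sup>2 / 2)"
  proof (rule has_integral_le[OF 2 1])
    fix s assume s: "s \<in> {0..t}"
    have "(?b + s) powr (p - 2) \<le> (?b + t) powr (p - 2)"
      using assms s by (intro powr_mono2) auto
    also have "\<dots> \<le> 2 powr (p - 2) * (?b powr (p - 2) + t powr (p - 2))"
      using assms by (intro powr_add_le) auto
    also have "?b powr (p - 2) \<le> ?m"
      by (auto simp: shift_weight_def)
    finally show "(?b + s) powr (p - 2) * s \<le> ?c * s"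
      using s by (intro mult_right_mono) auto
  qed
  then have "shifted (phi p \<delta>) a t \<le> ?c * (t\<^sup>2 / 2)"
    using assms by (simp add: shifted_phi_eq)
  also have "\<dots> \<le> ?c * t\<^sup>2"
    by (intro mult_left_mono) (auto simp: shift_weight_def)
  also have "\<dots> = 2 powr (p - 2) * (?m * t powr 2 + t powr p)"
    using assms powr_add[of t "p - 2" 2] by (simp add: algebra_simps)
  also have "\<dots> \<le> 2 powr p * (?m * t powr 2 + t powr p)"
    by (intro mult_right_mono powr_mono) (auto simp: shift_weight_def)
  finally show ?thesis .
qed

text \<open>Bounds the quadratic part of the growth by the \<open>p\<close>-th power part, up to a term that is integrable
  when \<open>b = \<delta> + \<bar>A\<bar>\<close> and \<open>A\<close> is \<open>p\<close>-integrable: replace \<open>b\<close> and \<open>t\<close> by their maximum.\<close>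
lemma shift_weight_mult_powr2_le:
  assumes "p \<ge> 2" "b \<ge> 0" "t \<ge> 0"
  shows "shift_weight p b * t powr 2 \<le> b powr p + t powr p"
proof (cases "p = 2")
  case False
  let ?M = "max b t"
  have "b powr (p - 2) * t powr 2 \<le> ?M powr (p - 2) * ?M powr 2"
    using assms by (intro mult_mono powr_mono2) auto
  also have "\<dots> = ?M powr p"
    using powr_add[of ?M "p - 2" 2] by simp
  also have "\<dots> \<le> b powr p + t powr p"
    by (auto simp: max_def)
  finally show ?thesis
    using False by (simp add: shift_weight_def)
qed (auto simp: shift_weight_def)

section \<open>Weighted Lebesgue and Sobolev spaces\<close>
abbreviation weighted_energy ::
    "(real^'d) set \<Rightarrow> real \<Rightarrow> (real^'d \<Rightarrow> real) \<Rightarrow> (real^'d \<Rightarrow> 'b::real_normed_vector) \<Rightarrow> real" where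
  "weighted_energy \<Omega> s \<sigma> u \<equiv> LINT x|lebesgue_on \<Omega>. norm (u x) powr s * \<sigma> x"

lemma weighted_norm_less_iff:
  assumes "s > 0" "c > 0" "\<And>x. 0 \<le> \<sigma> x"
  shows "weighted_norm \<Omega> s \<sigma> u < c \<longleftrightarrow> weighted_energy \<Omega> s \<sigma> u < c powr s"
proof -
  let ?E = "weighted_energy \<Omega> s \<sigma> u"
  have E: "?E \<ge> 0"
    using assms by (intro integral_nonneg_AE) auto
  have id: "(?E powr (1 / s)) powr s = ?E" "(c powr s) powr (1 / s) = c"
    using assms E by (auto simp: powr_powr)
  have "?E powr (1 / s) < c \<Longrightarrow> (?E powr (1 / s)) powr s < c powr s"
    using assms by (intro powr_less_mono2) auto
  moreover have "?E < c powr s \<Longrightarrow> ?E powr (1 / s) < (c powr s) powr (1 / s)"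
    using assms E by (intro powr_less_mono2) auto
  ultimately show ?thesis
    unfolding weighted_norm_def id by blast
qed

lemma weighted_norm_nonneg: "weighted_norm \<Omega> s \<sigma> u \<ge> 0"
  by (simp add: weighted_norm_def)

lemma weighted_Lp_linear_combination:
  fixes u v :: "real^'d \<Rightarrow> real"
  assumes s: "s \<ge> 0" and \<sigma>: "\<And>x. 0 \<le> \<sigma> x" "\<sigma> \<in> borel_measurable (lebesgue_on \<Omega>)"
    and u: "u \<in> weighted_Lp \<Omega> s \<sigma>" and v: "v \<in> weighted_Lp \<Omega> s \<sigma>"
  shows "(\<lambda>x. a * u x + b * v x) \<in> weighted_Lp \<Omega> s \<sigma>" (is ?mem)
    and "weighted_energy \<Omega> s \<sigma> (\<lambda>x. a * u x + b * v x) \<le>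
      2 powr s * (\<bar>a\<bar> powr s * weighted_energy \<Omega> s \<sigma> u + \<bar>b\<bar> powr s * weighted_energy \<Omega> s \<sigma> v)" (is ?le)
proof -
  let ?w = "\<lambda>x. norm (a * u x + b * v x) powr s * \<sigma> x"
  let ?g = "\<lambda>x. 2 powr s * (\<bar>a\<bar> powr s * (norm (u x) powr s * \<sigma> x) + \<bar>b\<bar> powr s * (norm (v x) powr s * \<sigma> x))"
  have [measurable]: "u \<in> borel_measurable (lebesgue_on \<Omega>)" "v \<in> borel_measurable (lebesgue_on \<Omega>)"
    "\<sigma> \<in> borel_measurable (lebesgue_on \<Omega>)"
    and int: "integrable (lebesgue_on \<Omega>) (\<lambda>x. norm (u x) powr s * \<sigma> x)"
      "integrable (lebesgue_on \<Omega>) (\<lambda>x. norm (v x) powr s * \<sigma> x)"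
    using u v \<sigma> by (auto simp: weighted_Lp_def)
  have le: "?w x \<le> ?g x" for x
  proof -
    have "norm (a * u x + b * v x) powr s \<le> (\<bar>a\<bar> * \<bar>u x\<bar> + \<bar>b\<bar> * \<bar>v x\<bar>) powr s"
      using s by (intro powr_mono2) (auto simp flip: abs_mult)
    also have "\<dots> \<le> 2 powr s * ((\<bar>a\<bar> * \<bar>u x\<bar>) powr s + (\<bar>b\<bar> * \<bar>v x\<bar>) powr s)"
      using s by (intro powr_add_le) auto
    finally have "?w x \<le> 2 powr s * ((\<bar>a\<bar> * \<bar>u x\<bar>) powr s + (\<bar>b\<bar> * \<bar>v x\<bar>) powr s) * \<sigma> x"
      using \<sigma>(1) by (intro mult_right_mono)
    then show ?thesis
      by (simp add: powr_mult algebra_simps)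
  qed
  have g: "integrable (lebesgue_on \<Omega>) ?g"
    using int by (intro integrable_mult_right Bochner_Integration.integrable_add)
  have w: "integrable (lebesgue_on \<Omega>) ?w"
  proof (rule Bochner_Integration.integrable_bound[OF g])
    show "AE x in lebesgue_on \<Omega>. norm (?w x) \<le> norm (?g x)"
      using le \<sigma>(1) by (intro AE_I2) (smt (verit) mult_nonneg_nonneg powr_ge_zero real_norm_def)
  qed measurable
  then show ?mem
    by (simp add: weighted_Lp_def)
  have "weighted_energy \<Omega> s \<sigma> (\<lambda>x. a * u x + b * v x) \<le> (LINT x|lebesgue_on \<Omega>. ?g x)"
    by (intro integral_mono w g le)
  also have "\<dots> = 2 powr s * (\<bar>a\<bar> powr s * weighted_energy \<Omega> s \<sigma> u + \<bar>b\<bar> powr s * weighted_energy \<Omega> s \<sigma> v)"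
    using int by simp
  finally show ?le .
qed

lemma linear_closed_weighted_Lp0:
  assumes "s \<ge> 0" "\<And>x. 0 \<le> \<sigma> x" "\<sigma> \<in> borel_measurable (lebesgue_on \<Omega>)"
  shows "linear_closed (weighted_Lp0 \<Omega> s \<sigma>)"
  using weighted_Lp_linear_combination(1)[OF assms]
  by (auto simp: linear_closed_def weighted_Lp0_def weighted_Lp_def zero_mean_def)

text \<open>The maps \<open>S\<close> to which \<open>unique_continuous_extension_comp\<close> is going to be applied: multiples of the
  identity and perturbations of the identity by \<open>z \<mapsto> F z * z1\<close> with a continuous functional \<open>F\<close>.\<close>
lemma continuous_at_zero_rank_one_perturbation:
  fixes z1 :: "real^'d \<Rightarrow> real" and F :: "(real^'d \<Rightarrow> real) \<Rightarrow> real"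
  assumes s: "s > 0" and \<sigma>: "\<And>x. 0 \<le> \<sigma> x" "\<sigma> \<in> borel_measurable (lebesgue_on \<Omega>)"
    and X: "X \<subseteq> weighted_Lp \<Omega> s \<sigma>" and z1: "z1 \<in> weighted_Lp \<Omega> s \<sigma>"
    and F: "continuous_at_zero X (weighted_norm \<Omega> s \<sigma>) abs F"
  shows "continuous_at_zero X (weighted_norm \<Omega> s \<sigma>) (weighted_norm \<Omega> s \<sigma>) (\<lambda>z y. a * z y + F z * z1 y)"
  unfolding continuous_at_zero_def
proof (intro allI impI)
  fix \<epsilon> :: real assume \<epsilon>: "\<epsilon> > 0"
  let ?E = "weighted_energy \<Omega> s \<sigma>"
  have E1: "?E z1 \<ge> 0"
    using \<sigma> by (intro integral_nonneg_AE) auto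
  define \<kappa> where "\<kappa> = \<epsilon> powr s / (2 * 2 powr s)"
  define \<theta> where "\<theta> = (\<kappa> / (?E z1 + 1)) powr (1 / s)"
  define \<eta> where "\<eta> = (\<kappa> / (\<bar>a\<bar> powr s + 1)) powr (1 / s)"
  have \<kappa>: "\<kappa> > 0"
    using \<epsilon> by (simp add: \<kappa>_def)
  have a1: "\<bar>a\<bar> powr s + 1 > 0"
    by (smt (verit) powr_ge_zero)
  have \<theta>: "\<theta> > 0" "\<theta> powr s = \<kappa> / (?E z1 + 1)"
    using \<kappa> E1 s by (auto simp: \<theta>_def powr_powr)
  have \<eta>: "\<eta> > 0" "\<eta> powr s = \<kappa> / (\<bar>a\<bar> powr s + 1)"
    using \<kappa> a1 s by (auto simp: \<eta>_def powr_powr)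
  obtain \<eta>' where \<eta>': "\<eta>' > 0" "\<And>u. u \<in> X \<Longrightarrow> weighted_norm \<Omega> s \<sigma> u < \<eta>' \<Longrightarrow> \<bar>F u\<bar> < \<theta>"
    using F \<theta>(1) unfolding continuous_at_zero_def by blast
  have "weighted_norm \<Omega> s \<sigma> (\<lambda>y. a * u y + F u * z1 y) < \<epsilon>"
    if u: "u \<in> X" "weighted_norm \<Omega> s \<sigma> u < min \<eta> \<eta>'" for u
  proof -
    have "?E u < \<eta> powr s"
      using u \<eta>(1) s \<sigma> weighted_norm_less_iff[of s \<eta> \<sigma> \<Omega> u] by simp
    then have "\<bar>a\<bar> powr s * ?E u \<le> \<bar>a\<bar> powr s * (\<kappa> / (\<bar>a\<bar> powr s + 1))"
      unfolding \<eta>(2) by (intro mult_left_mono) auto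
    also have "\<dots> < \<kappa>"
      using \<kappa> a1 by (simp add: field_simps)
    finally have 1: "\<bar>a\<bar> powr s * ?E u < \<kappa>" .
    have "\<bar>F u\<bar> powr s \<le> \<theta> powr s"
      using \<eta>'(2)[of u] u s by (intro powr_mono2) auto
    then have "\<bar>F u\<bar> powr s * ?E z1 \<le> \<kappa> / (?E z1 + 1) * ?E z1"
      unfolding \<theta>(2) using E1 by (intro mult_right_mono) auto
    also have "\<dots> < \<kappa>"
      using \<kappa> E1 by (simp add: field_simps)
    finally have 2: "\<bar>F u\<bar> powr s * ?E z1 < \<kappa>" .
    have "?E (\<lambda>y. a * u y + F u * z1 y) \<le> 2 powr s * (\<bar>a\<bar> powr s * ?E u + \<bar>F u\<bar> powr s * ?E z1)"
      using u X z1 s \<sigma> by (intro weighted_Lp_linear_combination(2)) auto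
    also have "\<dots> < 2 powr s * (\<kappa> + \<kappa>)"
      using 1 2 by (intro mult_strict_left_mono add_strict_mono) auto
    also have "\<dots> = \<epsilon> powr s"
      by (simp add: \<kappa>_def)
    finally show ?thesis
      using weighted_norm_less_iff[of s \<epsilon> \<sigma> \<Omega> "\<lambda>y. a * u y + F u * z1 y"] s \<sigma> \<epsilon> by simp
  qed
  then show "\<exists>\<eta>>0. \<forall>u\<in>X. weighted_norm \<Omega> s \<sigma> u < \<eta> \<longrightarrow> weighted_norm \<Omega> s \<sigma> (\<lambda>y. a * u y + F u * z1 y) < \<epsilon>"
    using \<eta>(1) \<eta>'(1) by (intro exI[of _ "min \<eta> \<eta>'"]) auto
qed

lemma borel_measurable_vec_componentwise:
  fixes v :: "'a \<Rightarrow> 'b::euclidean_space^'n"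
  assumes "\<And>i. (\<lambda>x. v x $ i) \<in> borel_measurable M"
  shows "v \<in> borel_measurable M"
proof (subst borel_measurable_euclidean_space, rule ballI)
  fix e :: "'b^'n" assume "e \<in> Basis"
  then obtain i b where "e = axis i b"
    by (auto simp: Basis_vec_def)
  then show "(\<lambda>x. v x \<bullet> e) \<in> borel_measurable M"
    using assms[of i] by (simp add: inner_axis)
qed

lemma norm_vec_le_sum_norm: "norm (v :: 'b::real_normed_vector^'n) \<le> (\<Sum>i\<in>UNIV. norm (v $ i))"
  unfolding norm_vec_def by (intro L2_set_le_sum) auto

lemma norm_vec_powr_le:
  fixes v :: "'b::real_normed_vector^'n"
  assumes "s \<ge> 0"
  shows "norm v powr s \<le> real CARD('n) powr s * (\<Sum>i\<in>UNIV. norm (v $ i) powr s)"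
proof -
  let ?N = "range (\<lambda>i. norm (v $ i))"
  have "Max ?N \<in> ?N"
    by (intro Max_in) auto
  then obtain k where "Max ?N = norm (v $ k)"
    by (rule imageE)
  then have k: "norm (v $ i) \<le> norm (v $ k)" for i
    using Max_ge[of ?N "norm (v $ i)"] by simp
  have "norm v \<le> (\<Sum>i\<in>(UNIV::'n set). norm (v $ k))"
    by (rule order_trans[OF norm_vec_le_sum_norm sum_mono]) (rule k)
  then have "norm v powr s \<le> (real CARD('n) * norm (v $ k)) powr s"
    using assms by (intro powr_mono2) auto
  also have "\<dots> = real CARD('n) powr s * norm (v $ k) powr s"
    by (simp add: powr_mult)
  also have "norm (v $ k) powr s \<le> (\<Sum>i\<in>UNIV. norm (v $ i) powr s)"
    by (intro member_le_sum) auto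
  finally show ?thesis
    by simp
qed

lemma weighted_Lp_vec:
  fixes v :: "real^'d \<Rightarrow> 'b::euclidean_space^'n"
  assumes s: "s \<ge> 0" and \<sigma>: "\<And>x. 0 \<le> \<sigma> x" "\<sigma> \<in> borel_measurable (lebesgue_on \<Omega>)"
    and v: "\<And>i. (\<lambda>x. v x $ i) \<in> weighted_Lp \<Omega> s \<sigma>"
  shows "v \<in> weighted_Lp \<Omega> s \<sigma>"
proof -
  have [measurable]: "v \<in> borel_measurable (lebesgue_on \<Omega>)"
    using v by (intro borel_measurable_vec_componentwise) (auto simp: weighted_Lp_def)
  have [measurable]: "\<sigma> \<in> borel_measurable (lebesgue_on \<Omega>)"
    by fact
  let ?g = "\<lambda>x. real CARD('n) powr s * (\<Sum>i\<in>UNIV. norm (v x $ i) powr s * \<sigma> x)"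
  have "integrable (lebesgue_on \<Omega>) (\<lambda>x. norm (v x) powr s * \<sigma> x)"
  proof (rule Bochner_Integration.integrable_bound)
    show "integrable (lebesgue_on \<Omega>) ?g"
      using v by (intro integrable_mult_right Bochner_Integration.integrable_sum)
        (auto simp: weighted_Lp_def)
    have "norm (v x) powr s * \<sigma> x \<le> ?g x" for x
      using mult_right_mono[OF norm_vec_powr_le[OF s, of "v x"] \<sigma>(1)[of x]]
      by (simp add: sum_distrib_right mult.assoc)
    then show "AE x in lebesgue_on \<Omega>. norm (norm (v x) powr s * \<sigma> x) \<le> norm (?g x)"
      using \<sigma>(1) by (intro AE_I2) (smt (verit) mult_nonneg_nonneg powr_ge_zero real_norm_def)
  qed measurable
  then show ?thesis
    by (simp add: weighted_Lp_def)
qed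

lemma weighted_sobolev0_vecD:
  fixes v :: "real^'d \<Rightarrow> real^'d"
  assumes "s \<ge> 0" "\<And>x. 0 \<le> \<sigma> x" "\<sigma> \<in> borel_measurable (lebesgue_on \<Omega>)"
    and v: "v \<in> vec_space (weighted_sobolev0 \<Omega> s \<sigma>)"
  shows "v \<in> weighted_Lp \<Omega> s \<sigma>" "weak_jac \<Omega> v \<in> weighted_Lp \<Omega> s \<sigma>"
    "integrable (lebesgue_on \<Omega>) (\<lambda>x. norm (v x))"
proof -
  show "v \<in> weighted_Lp \<Omega> s \<sigma>"
    using v by (intro weighted_Lp_vec[OF assms(1-3)]) (auto simp: vec_space_def weighted_sobolev0_def)
  show "weak_jac \<Omega> v \<in> weighted_Lp \<Omega> s \<sigma>"
    by (rule weighted_Lp_vec[OF assms(1-3)]) (use v in \<open>auto simp: vec_space_def weighted_sobolev0_def weak_jac_def\<close>)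
  have [measurable]: "v \<in> borel_measurable (lebesgue_on \<Omega>)"
    using \<open>v \<in> weighted_Lp \<Omega> s \<sigma>\<close> by (simp add: weighted_Lp_def)
  show "integrable (lebesgue_on \<Omega>) (\<lambda>x. norm (v x))"
  proof (rule Bochner_Integration.integrable_bound)
    show "integrable (lebesgue_on \<Omega>) (\<lambda>x. \<Sum>i\<in>UNIV. \<bar>v x $ i\<bar>)"
      using v by (auto simp: vec_space_def weighted_sobolev0_def sobolev11_0_def)
    show "AE x in lebesgue_on \<Omega>. norm (norm (v x)) \<le> norm (\<Sum>i\<in>UNIV. \<bar>v x $ i\<bar>)"
      using norm_le_l1_cart by (intro AE_I2) (auto intro!: order_trans[OF _ abs_ge_self])
  qed measurable
qed

text \<open>The bound of \<open>h\<close> by \<open>min 1 \<sigma>\<close> makes this elementary.  For \<open>l > 0\<close>, either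
  \<open>\<bar>v\<bar> \<le> 1 / l\<close>, or \<open>\<bar>v\<bar> \<le> l powr (s - 1) * \<bar>v\<bar> powr s\<close>; so \<open>\<bar>h \<bullet> v\<bar>\<close> is at most
  \<open>1 / l + l powr (s - 1) * \<bar>v\<bar> powr s * \<sigma>\<close>.  Choose \<open>l\<close> large first, and then the norm of \<open>v\<close> small.\<close>
lemma weighted_pairing_continuous_at_zero:
  fixes h :: "real^'d \<Rightarrow> real^'d"
  assumes \<Omega>: "\<Omega> \<in> lmeasurable" and s: "s \<ge> 1"
    and \<sigma>: "\<And>x. 0 \<le> \<sigma> x" "\<sigma> \<in> borel_measurable (lebesgue_on \<Omega>)"
    and h: "h \<in> borel_measurable (lebesgue_on \<Omega>)" "\<And>x. norm (h x) \<le> 1" "\<And>x. norm (h x) \<le> \<sigma> x"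
  shows "continuous_at_zero (vec_space (weighted_sobolev0 \<Omega> s \<sigma>)) (weighted_sobolev_norm \<Omega> s \<sigma>) abs
    (\<lambda>v. LINT x|lebesgue_on \<Omega>. h x \<bullet> v x)"
    and "\<And>v. v \<in> vec_space (weighted_sobolev0 \<Omega> s \<sigma>) \<Longrightarrow> integrable (lebesgue_on \<Omega>) (\<lambda>x. h x \<bullet> v x)"
proof -
  let ?Y = "vec_space (weighted_sobolev0 \<Omega> s \<sigma>)"
  let ?E = "weighted_energy \<Omega> s \<sigma>"
  note vecD = weighted_sobolev0_vecD[of s \<sigma> \<Omega>, OF _ \<sigma>]
  have fin: "integrable (lebesgue_on \<Omega>) (\<lambda>x. c)" for c :: real
    using \<Omega> by (intro finite_measure.integrable_const finite_measure_lebesgue_on)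
  show int: "integrable (lebesgue_on \<Omega>) (\<lambda>x. h x \<bullet> v x)" if v: "v \<in> ?Y" for v
  proof (rule Bochner_Integration.integrable_bound)
    show "integrable (lebesgue_on \<Omega>) (\<lambda>x. norm (v x))"
      using vecD(3)[OF _ v] s by simp
    have [measurable]: "v \<in> borel_measurable (lebesgue_on \<Omega>)" "h \<in> borel_measurable (lebesgue_on \<Omega>)"
      using vecD(1)[OF _ v] s h by (auto simp: weighted_Lp_def)
    show "(\<lambda>x. h x \<bullet> v x) \<in> borel_measurable (lebesgue_on \<Omega>)"
      by measurable
    have "\<bar>h x \<bullet> v x\<bar> \<le> norm (v x)" for x
      using Cauchy_Schwarz_ineq2[of "h x" "v x"] mult_right_mono[OF h(2)[of x], of "norm (v x)"] by simp
    then show "AE x in lebesgue_on \<Omega>. norm (h x \<bullet> v x) \<le> norm (norm (v x))"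
      by simp
  qed
  have bound: "\<bar>LINT x|lebesgue_on \<Omega>. h x \<bullet> v x\<bar> \<le> measure lebesgue \<Omega> / l + l powr (s - 1) * ?E v"
    if v: "v \<in> ?Y" and l: "l > 0" for v and l :: real
  proof -
    have E: "integrable (lebesgue_on \<Omega>) (\<lambda>x. norm (v x) powr s * \<sigma> x)"
      using vecD(1)[OF _ v] s by (simp add: weighted_Lp_def)
    have pw: "norm (h x \<bullet> v x) \<le> 1 / l + l powr (s - 1) * (norm (v x) powr s * \<sigma> x)" for x
    proof -
      have hv: "norm (h x \<bullet> v x) \<le> norm (h x) * norm (v x)"
        by (simp add: Cauchy_Schwarz_ineq2)
      have nn: "0 \<le> l powr (s - 1) * (norm (v x) powr s * \<sigma> x)"
        using \<sigma>(1) by simp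
      show ?thesis
      proof (cases "norm (v x) \<le> 1 / l")
        case True
        have "norm (h x) * norm (v x) \<le> 1 * (1 / l)"
          using True h(2)[of x] by (intro mult_mono) auto
        with hv nn show ?thesis by linarith
      next
        case False
        with l have pos: "norm (v x) > 0" and ge: "l * norm (v x) \<ge> 1"
          by (auto simp: field_simps not_le intro: less_trans[of 0 "1/l"] le_less_trans[OF _ False[unfolded not_le]])
        have "norm (v x) * 1 \<le> norm (v x) * (l * norm (v x)) powr (s - 1)"
          using ge s by (intro mult_left_mono ge_one_powr_ge_zero) auto
        also have "\<dots> = l powr (s - 1) * norm (v x) powr s"
          using pos l powr_add[of "norm (v x)" "s - 1" 1] by (simp add: powr_mult)
        finally have "norm (h x) * norm (v x) \<le> \<sigma> x * (l powr (s - 1) * norm (v x) powr s)"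
          using h(3)[of x] \<sigma>(1) by (intro mult_mono) auto
        also have "\<dots> = l powr (s - 1) * (norm (v x) powr s * \<sigma> x)"
          by (simp add: mult_ac)
        finally show ?thesis
          using hv l by (smt (verit) divide_pos_pos)
      qed
    qed
    have "\<bar>LINT x|lebesgue_on \<Omega>. h x \<bullet> v x\<bar> \<le> (LINT x|lebesgue_on \<Omega>. norm (h x \<bullet> v x))"
      using integral_norm_bound[of "lebesgue_on \<Omega>" "\<lambda>x. h x \<bullet> v x"] by simp
    also have "\<dots> \<le> (LINT x|lebesgue_on \<Omega>. 1 / l + l powr (s - 1) * (norm (v x) powr s * \<sigma> x))"
      by (intro integral_mono integrable_norm int v pw Bochner_Integration.integrable_add fin
          integrable_mult_right E)
    also have "\<dots> = measure lebesgue \<Omega> / l + l powr (s - 1) * ?E v"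
      using \<Omega> E fin by (simp add: measure_restrict_space fmeasurableD)
    finally show ?thesis .
  qed
  show "continuous_at_zero ?Y (weighted_sobolev_norm \<Omega> s \<sigma>) abs (\<lambda>v. LINT x|lebesgue_on \<Omega>. h x \<bullet> v x)"
    unfolding continuous_at_zero_def
  proof (intro allI impI)
    fix \<epsilon> :: real assume \<epsilon>: "\<epsilon> > 0"
    define l where "l = 2 * (measure lebesgue \<Omega> + 1) / \<epsilon>"
    define \<eta> where "\<eta> = (\<epsilon> / (2 * l powr (s - 1))) powr (1 / s)"
    have m: "measure lebesgue \<Omega> + 1 > 0"
      using measure_nonneg[of lebesgue \<Omega>] by linarith
    have l: "l > 0"
      using \<epsilon> m by (simp add: l_def)
    have \<eta>: "\<eta> > 0" "\<eta> powr s = \<epsilon> / (2 * l powr (s - 1))"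
      using \<epsilon> l s by (auto simp: \<eta>_def powr_powr)
    have "\<bar>LINT x|lebesgue_on \<Omega>. h x \<bullet> v x\<bar> < \<epsilon>"
      if v: "v \<in> ?Y" "weighted_sobolev_norm \<Omega> s \<sigma> v < \<eta>" for v
    proof -
      have "weighted_norm \<Omega> s \<sigma> v < \<eta>"
        using v weighted_norm_nonneg[of \<Omega> s \<sigma> "weak_jac \<Omega> v"] by (simp add: weighted_sobolev_norm_def)
      then have "?E v < \<epsilon> / (2 * l powr (s - 1))"
        using weighted_norm_less_iff[of s \<eta> \<sigma> \<Omega> v] s \<sigma> \<eta> by simp
      then have "l powr (s - 1) * ?E v < \<epsilon> / 2"
        using l by (simp add: field_simps)
      moreover have "measure lebesgue \<Omega> / l \<le> \<epsilon> / 2"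
        using \<epsilon> m by (simp add: l_def field_simps)
      ultimately show ?thesis
        using bound[OF v(1) l] by linarith
    qed
    with \<eta>(1) show "\<exists>\<eta>>0. \<forall>u\<in>?Y. weighted_sobolev_norm \<Omega> s \<sigma> u < \<eta> \<longrightarrow>
        \<bar>LINT x|lebesgue_on \<Omega>. h x \<bullet> u x\<bar> < \<epsilon>"
      by blast
  qed
qed

section \<open>Extensions for different weights agree\<close>
lemma integral_pairing_cong_AE:
  fixes h v w :: "real^'d \<Rightarrow> real^'d"
  assumes "\<Omega> \<in> sets lebesgue" "AE x in lebesgue_on \<Omega>. v x = w x"
  shows "(LINT x|lebesgue_on \<Omega>. h x \<bullet> v x) = (LINT x|lebesgue_on \<Omega>. h x \<bullet> w x)"
  using assms(2) by (intro integral_lebesgue_on_cong_AE[OF assms(1)]) (auto elim!: eventually_mono)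

lemma continuous_at_zero_diff:
  assumes "continuous_at_zero X N abs F" "continuous_at_zero X N abs G"
  shows "continuous_at_zero X N abs (\<lambda>z. F z - G z :: real)"
  unfolding continuous_at_zero_def
proof (intro allI impI)
  fix \<epsilon> :: real assume "\<epsilon> > 0"
  then have "\<epsilon> / 2 > 0"
    by simp
  then obtain \<eta> \<theta> where \<eta>: "\<eta> > 0" "\<forall>u\<in>X. N u < \<eta> \<longrightarrow> \<bar>F u\<bar> < \<epsilon> / 2"
    and \<theta>: "\<theta> > 0" "\<forall>u\<in>X. N u < \<theta> \<longrightarrow> \<bar>G u\<bar> < \<epsilon> / 2"
    using assms unfolding continuous_at_zero_def by blast
  have "\<bar>F u - G u\<bar> < \<epsilon>" if "u \<in> X" "N u < min \<eta> \<theta>" for u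
  proof -
    have "\<bar>F u\<bar> < \<epsilon> / 2" "\<bar>G u\<bar> < \<epsilon> / 2"
      using \<eta> \<theta> that by auto
    then show ?thesis by linarith
  qed
  then show "\<exists>\<eta>>0. \<forall>u\<in>X. N u < \<eta> \<longrightarrow> \<bar>F u - G u\<bar> < \<epsilon>"
    using \<eta>(1) \<theta>(1) by (intro exI[of _ "min \<eta> \<theta>"]) auto
qed

text \<open>Let \<open>D z = T2 z - T1 z\<close>, which vanishes for test functions \<open>z\<close>.  For a field \<open>h\<close> bounded by
  \<open>min 1 (min \<sigma> \<tau>)\<close>, the functional \<open>F z = \<integral> h \<bullet> D z\<close> is continuous on \<open>X\<close> and vanishes on test
  functions, so \<open>S z = z + F z * z1\<close> satisfies \<open>T1 (S z) = T1 z\<close> by uniqueness, i.e. \<open>F z * T1 z1 = 0\<close>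
  for every \<open>z1\<close>.  If \<open>T1 z1 \<noteq> 0\<close> for some \<open>z1\<close>, then \<open>F = 0\<close>, and taking for \<open>h\<close> a positive multiple of
  \<open>D z0\<close> gives \<open>D z0 = 0\<close>.  Otherwise \<open>T1\<close> vanishes, and so do \<open>B\<close> and \<open>T2\<close> on test functions; then
  doubling the argument does not change \<open>T2\<close> on test functions, hence not on \<open>X\<close>, so \<open>T2 = 0\<close> there.\<close>
lemma weighted_extensions_agree:
  fixes \<Omega> :: "(real^'d) set" and \<sigma> \<tau> :: "real^'d \<Rightarrow> real" and s q :: real
  defines "X \<equiv> weighted_Lp0 \<Omega> s \<sigma>" and "Y \<equiv> weighted_Lp0 \<Omega> q \<tau>"
  assumes \<Omega>: "\<Omega> \<in> lmeasurable" and s: "s \<ge> 1" and q: "q \<ge> 1"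
    and \<sigma>: "\<And>x. 0 \<le> \<sigma> x" "\<sigma> \<in> borel_measurable (lebesgue_on \<Omega>)" "AE x in lebesgue_on \<Omega>. 0 < \<sigma> x"
    and \<tau>: "\<And>x. 0 \<le> \<tau> x" "\<tau> \<in> borel_measurable (lebesgue_on \<Omega>)" "AE x in lebesgue_on \<Omega>. 0 < \<tau> x"
    and T1: "unique_continuous_extension \<Omega> B X (weighted_norm \<Omega> s \<sigma>)
      (vec_space (weighted_sobolev0 \<Omega> s \<sigma>)) (weighted_sobolev_norm \<Omega> s \<sigma>) T1"
    and T2: "unique_continuous_extension \<Omega> B Y (weighted_norm \<Omega> q \<tau>)
      (vec_space (weighted_sobolev0 \<Omega> q \<tau>)) (weighted_sobolev_norm \<Omega> q \<tau>) T2"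
    and sub: "X \<subseteq> Y" and dom: "norm_dominates X (weighted_norm \<Omega> s \<sigma>) (weighted_norm \<Omega> q \<tau>)"
    and z0: "z0 \<in> X"
  shows "AE x in lebesgue_on \<Omega>. T1 z0 x = T2 z0 x"
proof -
  let ?N1 = "weighted_norm \<Omega> s \<sigma>" and ?N2 = "weighted_norm \<Omega> q \<tau>"
  have \<Omega>': "\<Omega> \<in> sets lebesgue"
    using \<Omega> by (rule fmeasurableD)
  have X: "linear_closed X" and Y: "linear_closed Y"
    unfolding X_def Y_def using s q \<sigma> \<tau> by (auto intro!: linear_closed_weighted_Lp0)
  have X_Lp: "X \<subseteq> weighted_Lp \<Omega> s \<sigma>" and Y_Lp: "Y \<subseteq> weighted_Lp \<Omega> q \<tau>"
    by (auto simp: X_def Y_def weighted_Lp0_def)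
  note cong1 = weighted_sobolev_norm_cong_AE[OF \<Omega>', of _ _ s \<sigma>]
  note cong2 = weighted_sobolev_norm_cong_AE[OF \<Omega>', of _ _ q \<tau>]
  have lin1: "linear_extension \<Omega> B X (vec_space (weighted_sobolev0 \<Omega> s \<sigma>)) T1"
    and cont1: "continuous_at_zero X ?N1 (weighted_sobolev_norm \<Omega> s \<sigma>) T1"
    using T1 continuous_extension_iff_continuous_at_zero[where NY="weighted_sobolev_norm \<Omega> s \<sigma>", OF X cong1]
    unfolding unique_continuous_extension_def by blast+
  have lin2: "linear_extension \<Omega> B Y (vec_space (weighted_sobolev0 \<Omega> q \<tau>)) T2"
    and cont2: "continuous_at_zero Y ?N2 (weighted_sobolev_norm \<Omega> q \<tau>) T2"
    using T2 continuous_extension_iff_continuous_at_zero[where NY="weighted_sobolev_norm \<Omega> q \<tau>", OF Y cong2]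
    unfolding unique_continuous_extension_def by blast+
  have T1_Y: "T1 ` X \<subseteq> vec_space (weighted_sobolev0 \<Omega> s \<sigma>)"
    and T2_Y: "T2 ` Y \<subseteq> vec_space (weighted_sobolev0 \<Omega> q \<tau>)"
    using lin1 lin2 unfolding linear_extension_def by blast+
  have tests: "test_fun0 \<Omega> \<subseteq> X" "\<And>z. z \<in> test_fun0 \<Omega> \<Longrightarrow> AE x in lebesgue_on \<Omega>. T1 z x = B z x"
    "\<And>z. z \<in> test_fun0 \<Omega> \<Longrightarrow> AE x in lebesgue_on \<Omega>. T2 z x = B z x"
    using lin1 lin2 unfolding linear_extension_def by blast+
  have T1_lin: "AE x in lebesgue_on \<Omega>. T1 (\<lambda>y. a * z y + b * w y) x = a *\<^sub>R T1 z x + b *\<^sub>R T1 w x"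
    if "z \<in> X" "w \<in> X" for z w a b
    using lin1 that unfolding linear_extension_def by blast
  have T2_lin: "AE x in lebesgue_on \<Omega>. T2 (\<lambda>y. a * z y + b * w y) x = a *\<^sub>R T2 z x + b *\<^sub>R T2 w x"
    if "z \<in> X" "w \<in> X" for z w a b
    using lin2 that sub unfolding linear_extension_def by blast
  have T1_cong: "AE x in lebesgue_on \<Omega>. T1 z x = T1 w x"
    and T2_cong: "AE x in lebesgue_on \<Omega>. T2 z x = T2 w x"
    if "z \<in> X" "w \<in> X" "AE x in lebesgue_on \<Omega>. z x = w x" for z w
    using lin1 lin2 that sub unfolding linear_extension_def by blast+
  show ?thesis
  proof (cases "\<forall>z1\<in>X. AE x in lebesgue_on \<Omega>. T1 z1 x = 0")
    case True
    have "AE x in lebesgue_on \<Omega>. T2 (\<lambda>y. 2 * z0 y) x = T2 z0 x"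
    proof (rule unique_continuous_extension_comp[OF Y cong2 T2, where S="\<lambda>z y. 2 * z y"])
      have "continuous_at_zero Y ?N2 ?N2 (\<lambda>z y. 2 * z y + 0 * 0)"
        using q \<tau> Y Y_Lp unfolding linear_closed_def
        by (intro continuous_at_zero_rank_one_perturbation[where F="\<lambda>_. 0" and ?z1.0="\<lambda>_. 0"])
          (auto simp: continuous_at_zero_def intro: exI[of _ 1])
      then show "continuous_at_zero Y ?N2 ?N2 (\<lambda>z y. 2 * z y)"
        by simp
      show "(\<lambda>z y. 2 * z y) ` Y \<subseteq> Y"
      proof safe
        fix z assume "z \<in> Y"
        then have "(\<lambda>y. 2 * z y + 0 * z y) \<in> Y"
          using Y unfolding linear_closed_def by blast
        then show "(\<lambda>y. 2 * z y) \<in> Y" by simp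
      qed
      show "z0 \<in> Y"
        using z0 sub by blast
      fix z assume z: "z \<in> test_fun0 \<Omega>"
      then have "z \<in> X"
        using tests(1) by blast
      then have "AE x in lebesgue_on \<Omega>. T1 z x = 0" "AE x in lebesgue_on \<Omega>. T2 (\<lambda>y. 2 * z y + 0 * z y) x = 2 *\<^sub>R T2 z x + 0 *\<^sub>R T2 z x"
        using True T2_lin by blast+
      with tests(2,3)[OF z] show "AE x in lebesgue_on \<Omega>. T2 (\<lambda>y. 2 * z y) x = B z x"
        by eventually_elim simp
    qed (auto simp: fun_eq_iff algebra_simps elim: eventually_mono)
    moreover have "AE x in lebesgue_on \<Omega>. T2 (\<lambda>y. 2 * z0 y + 0 * z0 y) x = 2 *\<^sub>R T2 z0 x + 0 *\<^sub>R T2 z0 x"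
      by (rule T2_lin[OF z0 z0])
    moreover have "AE x in lebesgue_on \<Omega>. T1 z0 x = 0"
      using True z0 by blast
    ultimately show ?thesis
      by eventually_elim (simp add: scaleR_2)
  next
    case False
    then obtain z1 where z1: "z1 \<in> X" "\<not> (AE x in lebesgue_on \<Omega>. T1 z1 x = 0)"
      by blast
    define D where "D x = T2 z0 x - T1 z0 x" for x
    define h where "h x = (min 1 (min (\<sigma> x) (\<tau> x)) / (1 + norm (D x))) *\<^sub>R D x" for x
    have T1z0: "T1 z0 \<in> vec_space (weighted_sobolev0 \<Omega> s \<sigma>)" and T2z0: "T2 z0 \<in> vec_space (weighted_sobolev0 \<Omega> q \<tau>)"
      using T1_Y T2_Y z0 sub by blast+
    have [measurable]: "T1 z0 \<in> borel_measurable (lebesgue_on \<Omega>)" "T2 z0 \<in> borel_measurable (lebesgue_on \<Omega>)"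
      using weighted_sobolev0_vecD(1)[OF _ \<sigma>(1,2) T1z0] weighted_sobolev0_vecD(1)[OF _ \<tau>(1,2) T2z0] s q
      by (auto simp: weighted_Lp_def)
    have [measurable]: "\<sigma> \<in> borel_measurable (lebesgue_on \<Omega>)" "\<tau> \<in> borel_measurable (lebesgue_on \<Omega>)"
      by fact+
    have [measurable]: "D \<in> borel_measurable (lebesgue_on \<Omega>)"
      unfolding D_def by measurable
    have h: "h \<in> borel_measurable (lebesgue_on \<Omega>)"
      unfolding h_def by measurable
    have h_le: "norm (h x) \<le> min 1 (min (\<sigma> x) (\<tau> x))" for x
    proof -
      have "norm (h x) = min 1 (min (\<sigma> x) (\<tau> x)) * (norm (D x) / (1 + norm (D x)))"
        using \<sigma>(1) \<tau>(1) by (simp add: h_def abs_of_nonneg)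
      also have "\<dots> \<le> min 1 (min (\<sigma> x) (\<tau> x)) * 1"
        using \<sigma>(1) \<tau>(1) by (intro mult_left_mono) (auto simp: field_simps add_pos_nonneg)
      finally show ?thesis by simp
    qed
    have h_bounds: "norm (h x) \<le> 1" "norm (h x) \<le> \<sigma> x" "norm (h x) \<le> \<tau> x" for x
      using h_le[of x] by auto
    note pair1 = weighted_pairing_continuous_at_zero[OF \<Omega> s \<sigma>(1,2) h h_bounds(1,2)]
    note pair2 = weighted_pairing_continuous_at_zero[OF \<Omega> q \<tau>(1,2) h h_bounds(1,3)]
    define F where "F z = (LINT x|lebesgue_on \<Omega>. h x \<bullet> T2 z x) - (LINT x|lebesgue_on \<Omega>. h x \<bullet> T1 z x)" for z
    have F_cong: "F z = F w" if "z \<in> X" "w \<in> X" "AE x in lebesgue_on \<Omega>. z x = w x" for z w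
      unfolding F_def using T1_cong[OF that] T2_cong[OF that]
      by (simp add: integral_pairing_cong_AE[OF \<Omega>'] cong: integral_pairing_cong_AE[OF \<Omega>'])
    have F_lin: "F (\<lambda>y. a * z y + b * w y) = a * F z + b * F w" if zw: "z \<in> X" "w \<in> X" for z w a b
    proof -
      have i1: "integrable (lebesgue_on \<Omega>) (\<lambda>x. h x \<bullet> T1 z x)" "integrable (lebesgue_on \<Omega>) (\<lambda>x. h x \<bullet> T1 w x)"
        using pair1(2) T1_Y zw by blast+
      have i2: "integrable (lebesgue_on \<Omega>) (\<lambda>x. h x \<bullet> T2 z x)" "integrable (lebesgue_on \<Omega>) (\<lambda>x. h x \<bullet> T2 w x)"
        using pair2(2) T2_Y zw sub by blast+
      show ?thesis
        unfolding F_def integral_pairing_cong_AE[OF \<Omega>' T1_lin[OF zw]] integral_pairing_cong_AE[OF \<Omega>' T2_lin[OF zw]]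
        using i1 i2 by (simp add: inner_add_right algebra_simps)
    qed
    have F_cont: "continuous_at_zero X ?N1 abs F"
      unfolding F_def
    proof (rule continuous_at_zero_diff)
      have "continuous_at_zero X ?N1 (weighted_sobolev_norm \<Omega> q \<tau>) (\<lambda>z. T2 z)"
        using dom sub by (intro continuous_at_zero_comp[OF _ cont2]) (auto simp: norm_dominates_def)
      then show "continuous_at_zero X ?N1 abs (\<lambda>z. LINT x|lebesgue_on \<Omega>. h x \<bullet> T2 z x)"
        by (rule continuous_at_zero_comp[OF _ pair2(1)]) (use T2_Y sub in auto)
      show "continuous_at_zero X ?N1 abs (\<lambda>z. LINT x|lebesgue_on \<Omega>. h x \<bullet> T1 z x)"
        by (rule continuous_at_zero_comp[OF cont1 pair1(1) T1_Y])
    qed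
    let ?S = "\<lambda>z y. 1 * z y + F z * z1 y"
    have T1S: "AE x in lebesgue_on \<Omega>. T1 (?S z) x = T1 z x + F z *\<^sub>R T1 z1 x" if "z \<in> X" for z
      using T1_lin[OF that z1(1), of 1 "F z"] by simp
    have "AE x in lebesgue_on \<Omega>. T1 (?S z0) x = T1 z0 x"
    proof (rule unique_continuous_extension_comp[OF X cong1 T1, where S="?S"])
      show "?S ` X \<subseteq> X"
        using X z1(1) unfolding linear_closed_def by blast
      show "continuous_at_zero X ?N1 ?N1 ?S"
        using s \<sigma> X_Lp z1(1) F_cont by (intro continuous_at_zero_rank_one_perturbation) auto
      show "AE x in lebesgue_on \<Omega>. ?S z x = ?S w x"
        if "z \<in> X" "w \<in> X" "AE x in lebesgue_on \<Omega>. z x = w x" for z w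
        using F_cong[OF that] that(3) by (auto elim: eventually_mono)
      show "?S (\<lambda>y. a * z y + b * w y) = (\<lambda>y. a * ?S z y + b * ?S w y)"
        if "z \<in> X" "w \<in> X" for z w a b
        by (simp add: F_lin[OF that] algebra_simps fun_eq_iff)
      show "AE x in lebesgue_on \<Omega>. T1 (?S z) x = B z x" if z: "z \<in> test_fun0 \<Omega>" for z
      proof -
        have "AE x in lebesgue_on \<Omega>. T2 z x = T1 z x"
          using tests(2,3)[OF z] by eventually_elim simp
        then have "F z = 0"
          by (simp add: F_def integral_pairing_cong_AE[OF \<Omega>'])
        then show ?thesis
          using tests(2)[OF z] by simp
      qed
    qed (auto simp: z0)
    with T1S[OF z0] have "AE x in lebesgue_on \<Omega>. F z0 *\<^sub>R T1 z1 x = 0"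
      by eventually_elim simp
    with z1(2) have "F z0 = 0"
      by (cases "F z0 = 0") auto
    have int: "integrable (lebesgue_on \<Omega>) (\<lambda>x. h x \<bullet> T1 z0 x)" "integrable (lebesgue_on \<Omega>) (\<lambda>x. h x \<bullet> T2 z0 x)"
      using pair1(2) pair2(2) T1z0 T2z0 by blast+
    have hD: "h x \<bullet> D x = min 1 (min (\<sigma> x) (\<tau> x)) / (1 + norm (D x)) * (norm (D x))\<^sup>2" for x
      by (simp add: h_def power2_norm_eq_inner)
    have hD_nonneg: "0 \<le> h x \<bullet> D x" for x
      unfolding hD using \<sigma>(1) \<tau>(1) by simp
    have "integrable (lebesgue_on \<Omega>) (\<lambda>x. h x \<bullet> D x)" "(LINT x|lebesgue_on \<Omega>. h x \<bullet> D x) = F z0"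
      using int by (auto simp: D_def F_def inner_diff_right)
    then have "AE x in lebesgue_on \<Omega>. h x \<bullet> D x = 0"
      using \<open>F z0 = 0\<close> hD_nonneg integral_nonneg_eq_0_iff_AE[of "lebesgue_on \<Omega>" "\<lambda>x. h x \<bullet> D x"]
      by simp
    with \<sigma>(3) \<tau>(3) show ?thesis
    proof eventually_elim
      case (elim x)
      then have "D x = 0"
        unfolding hD by (smt (verit) divide_eq_0_iff mult_eq_0_iff norm_eq_zero norm_ge_zero power_eq_0_iff)
      then show ?case
        by (simp add: D_def)
    qed
  qed
qed

section \<open>The modular as a sum of two energies\<close>
lemma mu_weight_nonneg: "0 \<le> mu_weight \<Omega> p \<delta> A x"
  by (simp add: mu_weight_def)

lemma mu_weight_eq_shift_weight:
  "x \<in> \<Omega> \<Longrightarrow> mu_weight \<Omega> p \<delta> A x = shift_weight p (\<delta> + norm (A x))"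
  by (simp add: mu_weight_def shift_weight_def zero_ext_def)

lemma borel_measurable_mu_weight:
  assumes "A \<in> borel_measurable (lebesgue_on \<Omega>)"
  shows "mu_weight \<Omega> p \<delta> A \<in> borel_measurable (lebesgue_on \<Omega>)"
proof -
  have [measurable]: "A \<in> borel_measurable (lebesgue_on \<Omega>)" by fact
  have "(\<lambda>x. if p = 2 then 1 else (\<delta> + norm (A x)) powr (p - 2)) \<in> borel_measurable (lebesgue_on \<Omega>)"
    by measurable
  also have "(\<lambda>x. if p = 2 then 1 else (\<delta> + norm (A x)) powr (p - 2)) \<in> borel_measurable (lebesgue_on \<Omega>)
     \<longleftrightarrow> mu_weight \<Omega> p \<delta> A \<in> borel_measurable (lebesgue_on \<Omega>)"
    by (intro measurable_cong) (simp add: mu_weight_eq_shift_weight shift_weight_def)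
  finally show ?thesis .
qed

lemma powr_add_integrable:
  fixes A :: "real^'d \<Rightarrow> 'b::real_normed_vector"
  assumes \<Omega>: "\<Omega> \<in> lmeasurable" and p: "p \<ge> 0" and \<delta>: "\<delta> \<ge> 0" and A: "A \<in> weighted_Lp \<Omega> p (\<lambda>_. 1)"
  shows "integrable (lebesgue_on \<Omega>) (\<lambda>x. (\<delta> + norm (A x)) powr p)"
proof (rule Bochner_Integration.integrable_bound)
  have [measurable]: "A \<in> borel_measurable (lebesgue_on \<Omega>)"
    using A by (simp add: weighted_Lp_def)
  show "(\<lambda>x. (\<delta> + norm (A x)) powr p) \<in> borel_measurable (lebesgue_on \<Omega>)"
    by measurable
  have "integrable (lebesgue_on \<Omega>) (\<lambda>x. \<delta> powr p)"
    using \<Omega> by (intro finite_measure.integrable_const finite_measure_lebesgue_on)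
  then show "integrable (lebesgue_on \<Omega>) (\<lambda>x. 2 powr p * (\<delta> powr p + norm (A x) powr p))"
    using A by (intro integrable_mult_right Bochner_Integration.integrable_add) (auto simp: weighted_Lp_def)
  show "AE x in lebesgue_on \<Omega>. norm ((\<delta> + norm (A x)) powr p)
      \<le> norm (2 powr p * (\<delta> powr p + norm (A x) powr p))"
    using powr_add_le[OF \<delta> norm_ge_zero p] by (intro AE_I2) simp
qed

lemma weighted_norm_powr:
  fixes u :: "real^'d \<Rightarrow> 'b::real_normed_vector"
  assumes "s > 0" "\<And>x. 0 \<le> \<sigma> x"
  shows "weighted_norm \<Omega> s \<sigma> u powr s = weighted_energy \<Omega> s \<sigma> u"
proof -
  have "weighted_energy \<Omega> s \<sigma> u \<ge> 0"
    using assms by (intro integral_nonneg_AE) auto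
  then show ?thesis
    using assms by (simp add: weighted_norm_def powr_powr)
qed

lemma weighted_energy_nonneg:
  fixes u :: "real^'d \<Rightarrow> 'b::real_normed_vector"
  assumes "\<And>x. 0 \<le> \<sigma> x"
  shows "0 \<le> weighted_energy \<Omega> s \<sigma> u"
  using assms by (intro integral_nonneg_AE) auto

lemma weighted_energy_scaleR:
  fixes u :: "real^'d \<Rightarrow> 'b::real_normed_vector"
  shows "weighted_energy \<Omega> s \<sigma> (\<lambda>x. k *\<^sub>R u x) = \<bar>k\<bar> powr s * weighted_energy \<Omega> s \<sigma> u"
  by (simp add: powr_mult mult.assoc)

lemma weighted_Lp_scaleR_iff:
  fixes u :: "real^'d \<Rightarrow> 'b::euclidean_space"
  assumes "k \<noteq> 0"
  shows "(\<lambda>x. k *\<^sub>R u x) \<in> weighted_Lp \<Omega> s \<sigma> \<longleftrightarrow> u \<in> weighted_Lp \<Omega> s \<sigma>"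
proof -
  have "(\<lambda>x. k *\<^sub>R u x) \<in> borel_measurable (lebesgue_on \<Omega>) \<longleftrightarrow> u \<in> borel_measurable (lebesgue_on \<Omega>)"
  proof
    assume "(\<lambda>x. k *\<^sub>R u x) \<in> borel_measurable (lebesgue_on \<Omega>)"
    then have "(\<lambda>x. (1 / k) *\<^sub>R (k *\<^sub>R u x)) \<in> borel_measurable (lebesgue_on \<Omega>)"
      by (rule borel_measurable_scaleR[OF borel_measurable_const])
    moreover have "(\<lambda>x. (1 / k) *\<^sub>R (k *\<^sub>R u x)) = u"
      using assms by simp
    ultimately show "u \<in> borel_measurable (lebesgue_on \<Omega>)"
      by metis
  next
    assume "u \<in> borel_measurable (lebesgue_on \<Omega>)"
    then show "(\<lambda>x. k *\<^sub>R u x) \<in> borel_measurable (lebesgue_on \<Omega>)"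
      by (intro borel_measurable_scaleR borel_measurable_const)
  qed
  with assms show ?thesis
    by (simp add: weighted_Lp_def powr_mult mult.assoc)
qed

lemma norm_dominates_sum:
  assumes "norm_dominates V N N'" "norm_dominates W M M'"
    and "\<And>u. u \<in> X \<Longrightarrow> f u \<in> V" "\<And>u. u \<in> X \<Longrightarrow> g u \<in> W"
    and "\<And>u. u \<in> X \<Longrightarrow> N (f u) \<ge> 0" "\<And>u. u \<in> X \<Longrightarrow> M (g u) \<ge> 0"
  shows "norm_dominates X (\<lambda>u. N (f u) + M (g u)) (\<lambda>u. N' (f u) + M' (g u))"
  unfolding norm_dominates_def continuous_at_zero_def
proof (intro allI impI)
  fix \<epsilon> :: real assume "\<epsilon> > 0"
  then have "\<epsilon> / 2 > 0"
    by simp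
  then obtain \<eta> \<theta> where \<eta>: "\<eta> > 0" "\<forall>u\<in>V. N u < \<eta> \<longrightarrow> N' u < \<epsilon> / 2"
    and \<theta>: "\<theta> > 0" "\<forall>u\<in>W. M u < \<theta> \<longrightarrow> M' u < \<epsilon> / 2"
    using assms(1,2) unfolding norm_dominates_def continuous_at_zero_def by blast
  have "N' (f u) + M' (g u) < \<epsilon>" if "u \<in> X" "N (f u) + M (g u) < min \<eta> \<theta>" for u
  proof -
    have "N (f u) < \<eta>" "M (g u) < \<theta>"
      using assms(5,6)[OF that(1)] that(2) by auto
    then have "N' (f u) < \<epsilon> / 2" "M' (g u) < \<epsilon> / 2"
      using \<eta> \<theta> assms(3,4)[OF that(1)] by auto
    then show ?thesis by linarith
  qed
  then show "\<exists>\<eta>>0. \<forall>u\<in>X. N (f u) + M (g u) < \<eta> \<longrightarrow> N' (f u) + M' (g u) < \<epsilon>"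
    using \<eta>(1) \<theta>(1) by (intro exI[of _ "min \<eta> \<theta>"]) auto
qed

lemma weighted_energy_le_of_weighted_norm_le:
  fixes u :: "real^'d \<Rightarrow> 'b::real_normed_vector" and z :: "real^'d \<Rightarrow> 'c::real_normed_vector"
  assumes s: "s > 0" and \<sigma>: "\<And>x. 0 \<le> \<sigma> x"
    and le: "weighted_norm \<Omega> s \<sigma> u \<le> C * weighted_norm \<Omega> s \<sigma> z"
  shows "weighted_energy \<Omega> s \<sigma> u \<le> \<bar>C\<bar> powr s * weighted_energy \<Omega> s \<sigma> z"
proof -
  have "weighted_norm \<Omega> s \<sigma> u \<le> \<bar>C\<bar> * weighted_norm \<Omega> s \<sigma> z"
    using le mult_right_mono[OF abs_ge_self weighted_norm_nonneg] by (rule order_trans)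
  then have "weighted_norm \<Omega> s \<sigma> u powr s \<le> (\<bar>C\<bar> * weighted_norm \<Omega> s \<sigma> z) powr s"
    using s weighted_norm_nonneg by (intro powr_mono2) auto
  then show ?thesis
    by (simp add: powr_mult weighted_norm_powr[OF s \<sigma>])
qed

text \<open>The bounds that compare \<open>\<psi>\<close> with the sum of the two energies have constants depending on \<open>p\<close> only;
  the bounds of the weighted energy by the unweighted one depend on \<open>A\<close>, and may serve only for
  membership and continuity.\<close>
locale shifted_modular =
  fixes \<Omega> :: "(real^'d) set" and p \<delta> :: real and A :: "real^'d \<Rightarrow> real^'d^'d"
  assumes \<Omega>: "\<Omega> \<in> lmeasurable" and p: "p \<ge> 2" and \<delta>: "\<delta> \<ge> 0"
    and A: "A \<in> weighted_Lp \<Omega> p (\<lambda>_. 1)"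
begin

abbreviation "\<mu> \<equiv> mu_weight \<Omega> p \<delta> A"
abbreviation "\<psi> \<equiv> phi_shift p \<delta> A"

lemma mu_measurable [measurable]: "\<mu> \<in> borel_measurable (lebesgue_on \<Omega>)"
  using A by (intro borel_measurable_mu_weight) (simp add: weighted_Lp_def)

lemma modular_bounds:
  fixes u :: "real^'d \<Rightarrow> 'b::euclidean_space"
  assumes u: "u \<in> borel_measurable (lebesgue_on \<Omega>)"
  defines "N \<equiv> \<integral>\<^sup>+ x. ennreal (norm (u x) powr 2 * \<mu> x + norm (u x) powr p) \<partial>lebesgue_on \<Omega>"
  shows "ennreal (1 / (2 * p)) * N \<le> modular \<Omega> \<psi> u" "modular \<Omega> \<psi> u \<le> ennreal (2 powr p) * N"
proof -
  note [measurable] = u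
  let ?e = "\<lambda>x. norm (u x) powr 2 * \<mu> x + norm (u x) powr p"
  have "ennreal (1 / (2 * p)) * N = (\<integral>\<^sup>+ x. ennreal (1 / (2 * p)) * ennreal (?e x) \<partial>lebesgue_on \<Omega>)"
    unfolding N_def by (intro nn_integral_cmult[symmetric]) measurable
  also have "\<dots> \<le> modular \<Omega> \<psi> u"
    unfolding modular_def
  proof (rule nn_integral_mono)
    fix x assume "x \<in> space (lebesgue_on \<Omega>)"
    then have "?e x \<le> 2 * p * \<psi> x (norm (u x))"
      using shifted_phi_lower[OF p \<delta>, of "norm (A x)" "norm (u x)"]
      by (simp add: mu_weight_eq_shift_weight phi_shift_def mult.commute)
    then have "1 / (2 * p) * ?e x \<le> \<psi> x (norm (u x))"
      using p by (simp add: field_simps)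
    then show "ennreal (1 / (2 * p)) * ennreal (?e x) \<le> ennreal (\<psi> x (norm (u x)))"
      using p by (subst ennreal_mult[symmetric]) (auto simp: mu_weight_nonneg intro!: ennreal_leI)
  qed
  finally show "ennreal (1 / (2 * p)) * N \<le> modular \<Omega> \<psi> u" .
  have "modular \<Omega> \<psi> u \<le> (\<integral>\<^sup>+ x. ennreal (2 powr p) * ennreal (?e x) \<partial>lebesgue_on \<Omega>)"
    unfolding modular_def
  proof (rule nn_integral_mono)
    fix x assume "x \<in> space (lebesgue_on \<Omega>)"
    then have "\<psi> x (norm (u x)) \<le> 2 powr p * ?e x"
      using shifted_phi_upper[OF p \<delta>, of "norm (A x)" "norm (u x)"]
      by (simp add: mu_weight_eq_shift_weight phi_shift_def mult.commute)
    then show "ennreal (\<psi> x (norm (u x))) \<le> ennreal (2 powr p) * ennreal (?e x)"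
      by (subst ennreal_mult[symmetric]) (auto simp: mu_weight_nonneg intro!: ennreal_leI)
  qed
  also have "\<dots> = ennreal (2 powr p) * N"
    unfolding N_def by (intro nn_integral_cmult) measurable
  finally show "modular \<Omega> \<psi> u \<le> ennreal (2 powr p) * N" .
qed

text \<open>The factor \<open>l\<close> comes from applying \<open>shift_weight_mult_powr2_le\<close> to \<open>l * \<bar>u\<bar>\<close>.  Taking \<open>l\<close> large makes
  the first term small, although it does not depend on \<open>u\<close>; this is what turns the bound into
  continuity at \<open>0\<close>.\<close>
lemma weighted_Lp_subset_mu:
  fixes u :: "real^'d \<Rightarrow> 'b::euclidean_space"
  assumes u: "u \<in> weighted_Lp \<Omega> p (\<lambda>_. 1)"
  shows "u \<in> weighted_Lp \<Omega> 2 \<mu>"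
    and "l > 0 \<Longrightarrow> weighted_energy \<Omega> 2 \<mu> u \<le> (1 / l) powr 2 * (LINT x|lebesgue_on \<Omega>. (\<delta> + norm (A x)) powr p)
      + l powr (p - 2) * weighted_energy \<Omega> p (\<lambda>_. 1) u"
proof -
  note [measurable] = mu_measurable
  have [measurable]: "u \<in> borel_measurable (lebesgue_on \<Omega>)"
    and int: "integrable (lebesgue_on \<Omega>) (\<lambda>x. norm (u x) powr p * 1)"
    using u by (auto simp: weighted_Lp_def)
  let ?G = "\<lambda>x. (\<delta> + norm (A x)) powr p"
  have G: "integrable (lebesgue_on \<Omega>) ?G"
    using \<Omega> p \<delta> A by (intro powr_add_integrable) auto
  let ?f = "\<lambda>l x. (1 / l) powr 2 * ?G x + l powr (p - 2) * (norm (u x) powr p * 1)"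
  have f: "integrable (lebesgue_on \<Omega>) (?f l)" for l
    by (intro Bochner_Integration.integrable_add integrable_mult_right G int)
  have le: "norm (u x) powr 2 * \<mu> x \<le> ?f l x" if "x \<in> \<Omega>" "l > 0" for x l
  proof -
    have "\<mu> x * (l * norm (u x)) powr 2 \<le> ?G x + (l * norm (u x)) powr p"
      unfolding mu_weight_eq_shift_weight[OF that(1)] using p \<delta> that by (intro shift_weight_mult_powr2_le) auto
    then have "(1 / l) powr 2 * (\<mu> x * (l * norm (u x)) powr 2) \<le> (1 / l) powr 2 * (?G x + (l * norm (u x)) powr p)"
      by (intro mult_left_mono) auto
    moreover have "(1 / l) powr 2 * (\<mu> x * (l * norm (u x)) powr 2) = norm (u x) powr 2 * \<mu> x"
      using that by (simp add: powr_mult power_divide field_simps)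
    moreover have "(1 / l) powr 2 * (l * norm (u x)) powr p = l powr (p - 2) * (norm (u x) powr p * 1)"
      using that by (simp add: powr_mult powr_divide powr_diff)
    ultimately show ?thesis
      by (simp only: distrib_left)
  qed
  have E: "integrable (lebesgue_on \<Omega>) (\<lambda>x. norm (u x) powr 2 * \<mu> x)"
  proof (rule Bochner_Integration.integrable_bound[OF f[of 1]])
    show "AE x in lebesgue_on \<Omega>. norm (norm (u x) powr 2 * \<mu> x) \<le> norm (?f 1 x)"
      using le[of _ 1] by (intro AE_I2) (auto simp: mu_weight_nonneg intro: order_trans[OF _ abs_ge_self])
  qed measurable
  then show "u \<in> weighted_Lp \<Omega> 2 \<mu>"
    by (simp add: weighted_Lp_def)
  assume "l > 0"
  then have "weighted_energy \<Omega> 2 \<mu> u \<le> (LINT x|lebesgue_on \<Omega>. ?f l x)"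
    using le by (intro integral_mono E f) auto
  also have "\<dots> = (1 / l) powr 2 * (LINT x|lebesgue_on \<Omega>. ?G x) + l powr (p - 2) * weighted_energy \<Omega> p (\<lambda>_. 1) u"
    using G int by simp
  finally show "weighted_energy \<Omega> 2 \<mu> u \<le> (1 / l) powr 2 * (LINT x|lebesgue_on \<Omega>. (\<delta> + norm (A x)) powr p)
      + l powr (p - 2) * weighted_energy \<Omega> p (\<lambda>_. 1) u" .
qed

lemma nn_integral_energies:
  fixes u :: "real^'d \<Rightarrow> 'b::euclidean_space"
  assumes u: "u \<in> weighted_Lp \<Omega> p (\<lambda>_. 1)"
  shows "(\<integral>\<^sup>+ x. ennreal (norm (u x) powr 2 * \<mu> x + norm (u x) powr p) \<partial>lebesgue_on \<Omega>)
    = ennreal (weighted_energy \<Omega> 2 \<mu> u + weighted_energy \<Omega> p (\<lambda>_. 1) u)"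
proof -
  have "integrable (lebesgue_on \<Omega>) (\<lambda>x. norm (u x) powr 2 * \<mu> x)" "integrable (lebesgue_on \<Omega>) (\<lambda>x. norm (u x) powr p)"
    using u weighted_Lp_subset_mu(1)[OF u] by (auto simp: weighted_Lp_def)
  then show ?thesis
    by (subst nn_integral_eq_integral) (auto simp: mu_weight_nonneg)
qed

lemma orlicz_eq_weighted_Lp:
  "orlicz \<Omega> \<psi> = (weighted_Lp \<Omega> p (\<lambda>_. 1) :: (real^'d \<Rightarrow> 'b::euclidean_space) set)"
proof (intro set_eqI iffI)
  fix u :: "real^'d \<Rightarrow> 'b"
  assume u: "u \<in> weighted_Lp \<Omega> p (\<lambda>_. 1)"
  then have meas: "u \<in> borel_measurable (lebesgue_on \<Omega>)"
    by (simp add: weighted_Lp_def)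
  have "modular \<Omega> \<psi> u < \<infinity>"
    by (rule le_less_trans[OF modular_bounds(2)[OF meas, unfolded nn_integral_energies[OF u]]])
      (simp add: ennreal_mult_less_top)
  with meas show "u \<in> orlicz \<Omega> \<psi>"
    by (auto simp: orlicz_def intro!: exI[of _ "1::real"])
next
  fix u :: "real^'d \<Rightarrow> 'b"
  assume "u \<in> orlicz \<Omega> \<psi>"
  then obtain k where [measurable]: "u \<in> borel_measurable (lebesgue_on \<Omega>)" and k: "k > 0"
    and fin: "modular \<Omega> \<psi> (\<lambda>x. k *\<^sub>R u x) < \<infinity>"
    by (auto simp: orlicz_def)
  let ?v = "\<lambda>x. k *\<^sub>R u x"
  let ?N = "\<integral>\<^sup>+ x. ennreal (norm (?v x) powr 2 * \<mu> x + norm (?v x) powr p) \<partial>lebesgue_on \<Omega>"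
  have v: "?v \<in> borel_measurable (lebesgue_on \<Omega>)"
    by measurable
  have "ennreal (1 / (2 * p)) * ?N < \<infinity>"
    using modular_bounds(1)[OF v] fin by (rule le_less_trans)
  then have "?N < \<infinity>"
    using p by (auto simp: ennreal_mult_less_top)
  moreover have "(\<integral>\<^sup>+ x. ennreal (norm (norm (?v x) powr p)) \<partial>lebesgue_on \<Omega>) \<le> ?N"
    by (intro nn_integral_mono ennreal_leI) (simp add: mu_weight_nonneg)
  ultimately have "integrable (lebesgue_on \<Omega>) (\<lambda>x. norm (?v x) powr p)"
    using v by (intro integrableI_bounded) auto
  then have "?v \<in> weighted_Lp \<Omega> p (\<lambda>_. 1)"
    using v by (simp add: weighted_Lp_def)
  then show "u \<in> weighted_Lp \<Omega> p (\<lambda>_. 1)"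
    using k by (subst (asm) weighted_Lp_scaleR_iff) auto
qed

lemma norm_dominates_Lp_mu:
  "norm_dominates (weighted_Lp \<Omega> p (\<lambda>_. 1) :: (real^'d \<Rightarrow> 'b::euclidean_space) set)
    (weighted_norm \<Omega> p (\<lambda>_. 1)) (weighted_norm \<Omega> 2 \<mu>)"
  unfolding norm_dominates_def continuous_at_zero_def
proof (intro allI impI)
  fix \<epsilon> :: real assume \<epsilon>: "\<epsilon> > 0"
  let ?G = "LINT x|lebesgue_on \<Omega>. (\<delta> + norm (A x)) powr p"
  \<comment> \<open>\<open>l\<close> is chosen so that the term independent of \<open>u\<close> is at most half of \<open>\<epsilon>\<^sup>2\<close>.\<close>
  define M where "M = 2 * (?G + 1)"
  define l where "l = sqrt M / \<epsilon>"
  define \<eta> where "\<eta> = (\<epsilon> powr 2 / (2 * l powr (p - 2))) powr (1 / p)"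
  have "?G \<ge> 0"
    by (intro integral_nonneg_AE) auto
  then have M: "M > 0"
    unfolding M_def by (intro mult_pos_pos add_nonneg_pos) simp_all
  then have GM: "?G / M \<le> 1 / 2"
    unfolding pos_divide_le_eq[OF M] M_def by simp
  have l: "l > 0"
    using M \<epsilon> by (simp add: l_def)
  have \<eta>: "\<eta> > 0" "\<eta> powr p = \<epsilon> powr 2 / (2 * l powr (p - 2))"
    using p l \<epsilon> by (auto simp: \<eta>_def powr_powr)
  have "(1 / l) powr 2 = \<epsilon> powr 2 / M"
    using \<epsilon> M l by (simp add: l_def power_divide)
  then have "(1 / l) powr 2 * ?G = \<epsilon> powr 2 * (?G / M)"
    by simp
  also have "\<dots> \<le> \<epsilon> powr 2 * (1 / 2)"
    using GM by (intro mult_left_mono) auto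
  finally have 1: "(1 / l) powr 2 * ?G \<le> \<epsilon> powr 2 / 2"
    by simp
  have "weighted_norm \<Omega> 2 \<mu> u < \<epsilon>"
    if u: "u \<in> weighted_Lp \<Omega> p (\<lambda>_. 1)" "weighted_norm \<Omega> p (\<lambda>_. 1) u < \<eta>" for u :: "real^'d \<Rightarrow> 'b"
  proof -
    have "weighted_energy \<Omega> p (\<lambda>_. 1) u < \<epsilon> powr 2 / (2 * l powr (p - 2))"
      using weighted_norm_less_iff[of p \<eta> "\<lambda>_. 1" \<Omega> u] p \<eta> u by simp
    then have "l powr (p - 2) * weighted_energy \<Omega> p (\<lambda>_. 1) u < \<epsilon> powr 2 / 2"
      using l by (simp add: field_simps)
    with weighted_Lp_subset_mu(2)[OF u(1) l] 1 have "weighted_energy \<Omega> 2 \<mu> u < \<epsilon> powr 2"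
      by linarith
    then show ?thesis
      using weighted_norm_less_iff[of 2 \<epsilon> \<mu> \<Omega> u] \<epsilon> by (simp add: mu_weight_nonneg)
  qed
  with \<eta>(1) show "\<exists>\<eta>>0. \<forall>u\<in>weighted_Lp \<Omega> p (\<lambda>_. 1) :: (real^'d \<Rightarrow> 'b) set.
      weighted_norm \<Omega> p (\<lambda>_. 1) u < \<eta> \<longrightarrow> weighted_norm \<Omega> 2 \<mu> u < \<epsilon>"
    by blast
qed

lemma modular_scaleR_le:
  fixes u :: "real^'d \<Rightarrow> 'b::euclidean_space"
  assumes u: "u \<in> weighted_Lp \<Omega> p (\<lambda>_. 1)" and k: "k > 0"
  shows "modular \<Omega> \<psi> (\<lambda>x. (1 / k) *\<^sub>R u x) \<le> ennreal (2 powr p *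
    ((1 / k) powr 2 * weighted_energy \<Omega> 2 \<mu> u + (1 / k) powr p * weighted_energy \<Omega> p (\<lambda>_. 1) u))"
    and "ennreal ((1 / k) powr p * weighted_energy \<Omega> p (\<lambda>_. 1) u / (2 * p)) \<le> modular \<Omega> \<psi> (\<lambda>x. (1 / k) *\<^sub>R u x)"
proof -
  let ?v = "\<lambda>x. (1 / k) *\<^sub>R u x"
  have v: "?v \<in> weighted_Lp \<Omega> p (\<lambda>_. 1)"
    using u k by (subst weighted_Lp_scaleR_iff) auto
  then have meas: "?v \<in> borel_measurable (lebesgue_on \<Omega>)"
    by (simp add: weighted_Lp_def)
  have E: "weighted_energy \<Omega> 2 \<mu> ?v = (1 / k) powr 2 * weighted_energy \<Omega> 2 \<mu> u"
    "weighted_energy \<Omega> p (\<lambda>_. 1) ?v = (1 / k) powr p * weighted_energy \<Omega> p (\<lambda>_. 1) u"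
    using k weighted_energy_scaleR[where \<Omega>=\<Omega> and k="1 / k" and u=u] by (simp_all only: abs_of_pos zero_less_divide_1_iff)
  have nn: "0 \<le> (1 / k) powr 2 * weighted_energy \<Omega> 2 \<mu> u" "0 \<le> (1 / k) powr p * weighted_energy \<Omega> p (\<lambda>_. 1) u"
    by (intro mult_nonneg_nonneg weighted_energy_nonneg; simp add: mu_weight_nonneg)+
  note bounds = modular_bounds[OF meas, unfolded nn_integral_energies[OF v], unfolded E]
  have "ennreal ((1 / k) powr p * weighted_energy \<Omega> p (\<lambda>_. 1) u / (2 * p)) \<le>
    ennreal (1 / (2 * p)) * ennreal ((1 / k) powr 2 * weighted_energy \<Omega> 2 \<mu> u + (1 / k) powr p * weighted_energy \<Omega> p (\<lambda>_. 1) u)"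
    using p nn by (subst ennreal_mult[symmetric]) (auto intro!: ennreal_leI simp: divide_simps)
  with bounds(1) show "ennreal ((1 / k) powr p * weighted_energy \<Omega> p (\<lambda>_. 1) u / (2 * p)) \<le> modular \<Omega> \<psi> ?v"
    by (rule order_trans[rotated])
  show "modular \<Omega> \<psi> ?v \<le> ennreal (2 powr p *
    ((1 / k) powr 2 * weighted_energy \<Omega> 2 \<mu> u + (1 / k) powr p * weighted_energy \<Omega> p (\<lambda>_. 1) u))"
    using bounds(2) nn by (subst ennreal_mult) auto
qed

text \<open>The infimum of the empty set is an unspecified real number, so the Luxemburg norm is meaningful
  only where some positive multiple of the function has modular at most \<open>1\<close>.\<close>
lemma luxemburg_set_nonempty:
  fixes u :: "real^'d \<Rightarrow> 'b::euclidean_space"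
  assumes u: "u \<in> weighted_Lp \<Omega> p (\<lambda>_. 1)"
  shows "{k. k > 0 \<and> modular \<Omega> \<psi> (\<lambda>x. (1 / k) *\<^sub>R u x) \<le> 1} \<noteq> {}"
proof -
  let ?E = "weighted_energy \<Omega> 2 \<mu> u" and ?P = "weighted_energy \<Omega> p (\<lambda>_. 1) u"
  have nn: "?E \<ge> 0" "?P \<ge> 0"
    by (intro weighted_energy_nonneg; simp add: mu_weight_nonneg)+
  \<comment> \<open>With \<open>k \<ge> 1\<close> both powers of \<open>1 / k\<close> are at most the square, and \<open>k - 1 \<le> k\<^sup>2\<close>.\<close>
  define k where "k = 1 + 2 powr p * (?E + ?P)"
  have k: "k \<ge> 1"
    using nn by (simp add: k_def)
  have "(1 / k) powr p \<le> (1 / k) powr 2"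
    using k p by (intro powr_mono') auto
  then have "2 powr p * ((1 / k) powr 2 * ?E + (1 / k) powr p * ?P) \<le> 2 powr p * ((1 / k) powr 2 * ?E + (1 / k) powr 2 * ?P)"
    using nn by (intro mult_left_mono add_mono mult_right_mono) auto
  also have "\<dots> = (1 / k) powr 2 * (k - 1)"
    by (simp add: k_def algebra_simps)
  also have "\<dots> \<le> (1 / k) powr 2 * k\<^sup>2"
    using k by (intro mult_left_mono) (auto simp: power2_eq_square intro: order_trans[of _ "1 * k"])
  also have "\<dots> = 1"
    using k by (simp add: power_divide)
  finally have "ennreal (2 powr p * ((1 / k) powr 2 * ?E + (1 / k) powr p * ?P)) \<le> 1"
    by (simp only: ennreal_le_1)
  moreover have "k > 0"
    using k by simp
  ultimately have "modular \<Omega> \<psi> (\<lambda>x. (1 / k) *\<^sub>R u x) \<le> 1"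
    using order_trans[OF modular_scaleR_le(1)[OF u]] by blast
  with \<open>k > 0\<close> show ?thesis
    by blast
qed

lemma luxemburg_nonneg:
  fixes u :: "real^'d \<Rightarrow> 'b::euclidean_space"
  assumes u: "u \<in> weighted_Lp \<Omega> p (\<lambda>_. 1)"
  shows "luxemburg \<Omega> \<psi> u \<ge> 0"
  unfolding luxemburg_def by (intro cInf_greatest luxemburg_set_nonempty[OF u]) auto

lemma norm_dominates_luxemburg_Lp:
  "norm_dominates (weighted_Lp \<Omega> p (\<lambda>_. 1) :: (real^'d \<Rightarrow> 'b::euclidean_space) set)
    (luxemburg \<Omega> \<psi>) (weighted_norm \<Omega> p (\<lambda>_. 1))"
  unfolding norm_dominates_def continuous_at_zero_def
proof (intro allI impI)
  fix \<epsilon> :: real assume \<epsilon>: "\<epsilon> > 0"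
  have "weighted_norm \<Omega> p (\<lambda>_. 1) u < \<epsilon>"
    if u: "u \<in> weighted_Lp \<Omega> p (\<lambda>_. 1)" "luxemburg \<Omega> \<psi> u < \<epsilon> / (2 * p)" for u :: "real^'d \<Rightarrow> 'b"
  proof -
    let ?P = "weighted_energy \<Omega> p (\<lambda>_. 1) u"
    obtain k where k: "k > 0" "modular \<Omega> \<psi> (\<lambda>x. (1 / k) *\<^sub>R u x) \<le> 1" "k < \<epsilon> / (2 * p)"
      using cInf_lessD[OF luxemburg_set_nonempty[OF u(1)] u(2)[unfolded luxemburg_def]] by blast
    have "ennreal ((1 / k) powr p * ?P / (2 * p)) \<le> 1"
      using modular_scaleR_le(2)[OF u(1) k(1)] k(2) by (rule order_trans)
    then have "(1 / k) powr p * ?P \<le> 2 * p"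
      using p by (simp add: divide_simps)
    then have "?P \<le> 2 * p * k powr p"
      using k(1) by (simp add: powr_divide divide_simps)
    also have "\<dots> < 2 * p * (\<epsilon> / (2 * p)) powr p"
      using k p by (intro mult_strict_left_mono powr_less_mono2) auto
    also have "\<dots> = (2 * p / (2 * p) powr p) * \<epsilon> powr p"
      using \<epsilon> p by (simp add: powr_divide)
    also have "\<dots> \<le> 1 * \<epsilon> powr p"
      using p powr_mono[of 1 p "2 * p"] by (intro mult_right_mono) (auto simp: divide_simps)
    finally show ?thesis
      using weighted_norm_less_iff[of p \<epsilon> "\<lambda>_. 1" \<Omega> u] \<epsilon> p by simp
  qed
  then show "\<exists>\<eta>>0. \<forall>u\<in>weighted_Lp \<Omega> p (\<lambda>_. 1) :: (real^'d \<Rightarrow> 'b) set.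
      luxemburg \<Omega> \<psi> u < \<eta> \<longrightarrow> weighted_norm \<Omega> p (\<lambda>_. 1) u < \<epsilon>"
    using \<epsilon> p by (intro exI[of _ "\<epsilon> / (2 * p)"]) auto
qed

lemma norm_dominates_Lp_luxemburg:
  "norm_dominates (weighted_Lp \<Omega> p (\<lambda>_. 1) :: (real^'d \<Rightarrow> 'b::euclidean_space) set)
    (weighted_norm \<Omega> p (\<lambda>_. 1)) (luxemburg \<Omega> \<psi>)"
  unfolding norm_dominates_def continuous_at_zero_def
proof (intro allI impI)
  fix \<epsilon> :: real assume \<epsilon>: "\<epsilon> > 0"
  let ?L = "weighted_Lp \<Omega> p (\<lambda>_. 1) :: (real^'d \<Rightarrow> 'b) set"
  define k where "k = \<epsilon> / 2"
  have k: "k > 0" "k < \<epsilon>"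
    using \<epsilon> by (auto simp: k_def)
  define \<theta> where "\<theta> = (k powr 2 / (2 * 2 powr p)) powr (1 / 2)"
  define \<eta>1 where "\<eta>1 = (k powr p / (2 * 2 powr p)) powr (1 / p)"
  have \<theta>: "\<theta> > 0" "\<theta> powr 2 = k powr 2 / (2 * 2 powr p)"
    using k by (auto simp: \<theta>_def powr_powr simp del: powr_numeral)
  have \<eta>1: "\<eta>1 > 0" "\<eta>1 powr p = k powr p / (2 * 2 powr p)"
    using k p by (auto simp: \<eta>1_def powr_powr)
  obtain \<eta>2 where \<eta>2: "\<eta>2 > 0" "\<forall>u\<in>?L. weighted_norm \<Omega> p (\<lambda>_. 1) u < \<eta>2 \<longrightarrow> weighted_norm \<Omega> 2 \<mu> u < \<theta>"
    using norm_dominates_Lp_mu \<theta>(1) unfolding norm_dominates_def continuous_at_zero_def by blast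
  have "luxemburg \<Omega> \<psi> u < \<epsilon>"
    if u: "u \<in> ?L" "weighted_norm \<Omega> p (\<lambda>_. 1) u < min \<eta>1 \<eta>2" for u
  proof -
    have "weighted_norm \<Omega> 2 \<mu> u < \<theta>"
      using \<eta>2(2) u by simp
    then have "weighted_energy \<Omega> 2 \<mu> u < k powr 2 / (2 * 2 powr p)"
      unfolding \<theta>(2)[symmetric] using weighted_norm_less_iff[of 2 \<theta> \<mu> \<Omega> u] \<theta>(1)
      by (simp add: mu_weight_nonneg)
    then have 1: "2 powr p * ((1 / k) powr 2 * weighted_energy \<Omega> 2 \<mu> u) \<le> 1 / 2"
      using k by (simp add: powr_divide field_simps)
    have "weighted_energy \<Omega> p (\<lambda>_. 1) u < k powr p / (2 * 2 powr p)"
      unfolding \<eta>1(2)[symmetric] using weighted_norm_less_iff[of p \<eta>1 "\<lambda>_. 1" \<Omega> u] \<eta>1(1) p u by simp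
    then have 2: "2 powr p * ((1 / k) powr p * weighted_energy \<Omega> p (\<lambda>_. 1) u) \<le> 1 / 2"
      using k by (simp add: powr_divide field_simps)
    have "2 powr p * ((1 / k) powr 2 * weighted_energy \<Omega> 2 \<mu> u + (1 / k) powr p * weighted_energy \<Omega> p (\<lambda>_. 1) u) \<le> 1"
      unfolding distrib_left using 1 2 by linarith
    then have "ennreal (2 powr p * ((1 / k) powr 2 * weighted_energy \<Omega> 2 \<mu> u + (1 / k) powr p * weighted_energy \<Omega> p (\<lambda>_. 1) u)) \<le> 1"
      by simp
    with modular_scaleR_le(1)[OF u(1) k(1)] have "modular \<Omega> \<psi> (\<lambda>x. (1 / k) *\<^sub>R u x) \<le> 1"
      by (rule order_trans)
    then have "luxemburg \<Omega> \<psi> u \<le> k"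
      unfolding luxemburg_def using k by (intro cInf_lower bdd_belowI[of _ 0]) auto
    with k show ?thesis by simp
  qed
  then show "\<exists>\<eta>>0. \<forall>u\<in>?L. weighted_norm \<Omega> p (\<lambda>_. 1) u < \<eta> \<longrightarrow> luxemburg \<Omega> \<psi> u < \<epsilon>"
    using \<eta>1(1) \<eta>2(1) by (intro exI[of _ "min \<eta>1 \<eta>2"]) auto
qed

text \<open>Equality of the spaces is needed on the nose: uniqueness of the extension refers to all maps with
  values in the target space.\<close>
lemma orlicz0_eq_weighted_Lp0: "orlicz0 \<Omega> \<psi> = weighted_Lp0 \<Omega> p (\<lambda>_. 1)"
  by (simp add: orlicz0_def weighted_Lp0_def orlicz_eq_weighted_Lp)

lemma sobolev_orlicz0_eq_weighted_sobolev0: "sobolev_orlicz0 \<Omega> \<psi> = weighted_sobolev0 \<Omega> p (\<lambda>_. 1)"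
  by (simp add: sobolev_orlicz0_def weighted_sobolev0_def orlicz_eq_weighted_Lp)

lemma norm_dominates_sobolev_norms:
  defines "Y \<equiv> vec_space (weighted_sobolev0 \<Omega> p (\<lambda>_. 1))"
  shows "norm_dominates Y (weighted_sobolev_norm \<Omega> p (\<lambda>_. 1)) (sobolev_orlicz_norm \<Omega> \<psi>)"
    and "norm_dominates Y (sobolev_orlicz_norm \<Omega> \<psi>) (weighted_sobolev_norm \<Omega> p (\<lambda>_. 1))"
proof -
  have Y: "v \<in> weighted_Lp \<Omega> p (\<lambda>_. 1)" "weak_jac \<Omega> v \<in> weighted_Lp \<Omega> p (\<lambda>_. 1)" if "v \<in> Y" for v
    using weighted_sobolev0_vecD[of p "\<lambda>_. 1" \<Omega> v] that p by (auto simp: Y_def)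
  show "norm_dominates Y (weighted_sobolev_norm \<Omega> p (\<lambda>_. 1)) (sobolev_orlicz_norm \<Omega> \<psi>)"
    unfolding weighted_sobolev_norm_def[abs_def] sobolev_orlicz_norm_def[abs_def]
    by (rule norm_dominates_sum[OF norm_dominates_Lp_luxemburg norm_dominates_Lp_luxemburg])
      (simp_all add: Y weighted_norm_nonneg)
  show "norm_dominates Y (sobolev_orlicz_norm \<Omega> \<psi>) (weighted_sobolev_norm \<Omega> p (\<lambda>_. 1))"
    unfolding weighted_sobolev_norm_def[abs_def] sobolev_orlicz_norm_def[abs_def]
    by (rule norm_dominates_sum[OF norm_dominates_luxemburg_Lp norm_dominates_luxemburg_Lp])
      (simp_all add: Y luxemburg_nonneg)
qed

lemma modular_le_of_energy_le:
  fixes u :: "real^'d \<Rightarrow> 'b::euclidean_space" and z :: "real^'d \<Rightarrow> 'c::euclidean_space"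
  assumes u: "u \<in> weighted_Lp \<Omega> p (\<lambda>_. 1)" and z: "z \<in> weighted_Lp \<Omega> p (\<lambda>_. 1)" and "a \<ge> 0" "b \<ge> 0"
    and "weighted_energy \<Omega> 2 \<mu> u \<le> a * weighted_energy \<Omega> 2 \<mu> z"
    and "weighted_energy \<Omega> p (\<lambda>_. 1) u \<le> b * weighted_energy \<Omega> p (\<lambda>_. 1) z"
  shows "modular \<Omega> \<psi> u \<le> ennreal (2 powr p * (a + b) * (2 * p)) * modular \<Omega> \<psi> z"
proof -
  have prod1: "ennreal (2 powr p) * ennreal ((a + b) * n) = ennreal (2 powr p * (a + b)) * ennreal n"
    if "n \<ge> 0" for n
    using assms(3,4) that by (simp add: ennreal_mult[symmetric] mult.assoc)
  have prod2: "n = ennreal (2 * p) * (ennreal (1 / (2 * p)) * n)" for n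
    using p by (simp add: mult.assoc[symmetric] ennreal_mult[symmetric])
  let ?N = "ennreal (weighted_energy \<Omega> 2 \<mu> z + weighted_energy \<Omega> p (\<lambda>_. 1) z)"
  have nn: "0 \<le> weighted_energy \<Omega> 2 \<mu> z" "0 \<le> weighted_energy \<Omega> p (\<lambda>_. 1) z"
    by (intro weighted_energy_nonneg; simp add: mu_weight_nonneg)+
  have meas: "u \<in> borel_measurable (lebesgue_on \<Omega>)" "z \<in> borel_measurable (lebesgue_on \<Omega>)"
    using u z by (auto simp: weighted_Lp_def)
  have "weighted_energy \<Omega> 2 \<mu> u + weighted_energy \<Omega> p (\<lambda>_. 1) u
      \<le> a * weighted_energy \<Omega> 2 \<mu> z + b * weighted_energy \<Omega> p (\<lambda>_. 1) z"
    using assms by (intro add_mono)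
  also have "\<dots> \<le> (a + b) * weighted_energy \<Omega> 2 \<mu> z + (a + b) * weighted_energy \<Omega> p (\<lambda>_. 1) z"
    using assms nn by (intro add_mono mult_right_mono) auto
  finally have sum: "weighted_energy \<Omega> 2 \<mu> u + weighted_energy \<Omega> p (\<lambda>_. 1) u
      \<le> (a + b) * (weighted_energy \<Omega> 2 \<mu> z + weighted_energy \<Omega> p (\<lambda>_. 1) z)"
    by (simp only: distrib_left)
  have "modular \<Omega> \<psi> u \<le> ennreal (2 powr p) *
      ennreal (weighted_energy \<Omega> 2 \<mu> u + weighted_energy \<Omega> p (\<lambda>_. 1) u)"
    using modular_bounds(2)[OF meas(1)] by (simp only: nn_integral_energies[OF u])
  also have "\<dots> \<le> ennreal (2 powr p) * ennreal ((a + b) * (weighted_energy \<Omega> 2 \<mu> z + weighted_energy \<Omega> p (\<lambda>_. 1) z))"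
    by (intro mult_left_mono ennreal_leI sum) simp
  also have "\<dots> = ennreal (2 powr p * (a + b)) * ?N"
    by (rule prod1) (intro add_nonneg_nonneg nn)
  finally have le: "modular \<Omega> \<psi> u \<le> ennreal (2 powr p * (a + b)) * ?N" .
  have "?N = ennreal (2 * p) * (ennreal (1 / (2 * p)) * ?N)"
    by (rule prod2)
  also have "\<dots> \<le> ennreal (2 * p) * modular \<Omega> \<psi> z"
    using modular_bounds(1)[OF meas(2)] unfolding nn_integral_energies[OF z] by (rule mult_left_mono) simp
  finally have "ennreal (2 powr p * (a + b)) * ?N \<le> ennreal (2 powr p * (a + b)) * (ennreal (2 * p) * modular \<Omega> \<psi> z)"
    by (rule mult_left_mono) simp
  also have "ennreal (2 powr p * (a + b)) * (ennreal (2 * p) * modular \<Omega> \<psi> z) =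
      ennreal (2 powr p * (a + b) * (2 * p)) * modular \<Omega> \<psi> z"
    using assms p by (subst (2) ennreal_mult) (auto simp: mult.assoc)
  finally show ?thesis
    using le by (rule order_trans[rotated])
qed

end

section \<open>The Bogovskii operator on Orlicz spaces\<close>
lemma one_in_Ap: "(\<lambda>_::real^'d. 1) \<in> Ap s"
proof -
  have mean: "ball_mean (ball x r) (\<lambda>_. 1) = 1" if "r > 0" for x :: "real^'d" and r
  proof -
    have "emeasure lebesgue (ball x r) \<noteq> \<infinity>"
      using emeasure_lborel_ball_finite[of x r] by simp
    moreover have "emeasure lebesgue (ball x r) \<noteq> 0"
      using content_ball_pos[OF that, of x] by (auto simp: measure_def)
    ultimately show ?thesis
      by (simp add: ball_mean_def emeasure_restrict_space ennreal_divide_self less_top)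
  qed
  have "Ap_const s (\<lambda>_::real^'d. 1) \<le> 1"
    unfolding Ap_const_def
  proof (rule SUP_least)
    fix i :: "(real^'d) \<times> real" assume "i \<in> UNIV \<times> {0<..}"
    then show "(case i of (x, r) \<Rightarrow> ball_mean (ball x r) (\<lambda>_. 1) *
        epowr (ball_mean (ball x r) (\<lambda>y. 1 powr (1 - s / (s - 1)))) (s - 1)) \<le> 1"
      by (auto simp: mean epowr_def)
  qed
  then have "Ap_const s (\<lambda>_::real^'d. 1) < \<infinity>"
    by (rule le_less_trans) simp
  moreover have "integrable (lebesgue_on K) (\<lambda>_. 1::real)" if "compact K" for K :: "(real^'d) set"
    using lmeasurable_compact[OF that] by (intro finite_measure.integrable_const finite_measure_lebesgue_on)
  ultimately show ?thesis
    by (simp add: Ap_def weight_def loc_integrable_def)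
qed

theorem lemma20:
  fixes \<Omega> :: "(real^'d) set" and B :: "(real^'d \<Rightarrow> real) \<Rightarrow> real^'d \<Rightarrow> real^'d" and p :: real
  assumes "CARD('d) \<in> {2, 3}"
    and "polyhedral_lipschitz_domain \<Omega>"
    and "bogovskii_operator \<Omega> B"
    and "p \<ge> 2"
  shows "\<exists>c :: ennreal \<Rightarrow> real. (\<forall>K. c K > 0) \<and>
    (\<forall>\<delta> \<ge> 0. \<forall>A :: real^'d \<Rightarrow> real^'d^'d.
       A \<in> weighted_Lp \<Omega> p (\<lambda>_. 1) \<and> mu_weight \<Omega> p \<delta> A \<in> Ap 2 \<longrightarrow>
       (\<exists>T. unique_continuous_extension \<Omega> B
              (orlicz0 \<Omega> (phi_shift p \<delta> A)) (luxemburg \<Omega> (phi_shift p \<delta> A))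
              (vec_space (sobolev_orlicz0 \<Omega> (phi_shift p \<delta> A))) (sobolev_orlicz_norm \<Omega> (phi_shift p \<delta> A)) T \<and>
            (\<forall>z \<in> orlicz0 \<Omega> (phi_shift p \<delta> A).
               modular \<Omega> (phi_shift p \<delta> A) (weak_jac \<Omega> (T z))
               \<le> ennreal (c (Ap_const 2 (mu_weight \<Omega> p \<delta> A))) * modular \<Omega> (phi_shift p \<delta> A) z)))"
proof -
  note p = \<open>p \<ge> 2\<close>
  have \<Omega>: "\<Omega> \<in> lmeasurable"
    using assms(2) by (auto simp: polyhedral_lipschitz_domain_def lipschitz_domain_def intro: lmeasurable_open)
  then have \<Omega>': "\<Omega> \<in> sets lebesgue"
    by (rule fmeasurableD)
  have bog: "\<forall>s>1. \<exists>C :: ennreal \<Rightarrow> real. \<forall>\<sigma> \<in> Ap s. \<exists>T.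
      unique_continuous_extension \<Omega> B (weighted_Lp0 \<Omega> s \<sigma>) (weighted_norm \<Omega> s \<sigma>)
        (vec_space (weighted_sobolev0 \<Omega> s \<sigma>)) (weighted_sobolev_norm \<Omega> s \<sigma>) T \<and>
      (\<forall>z \<in> weighted_Lp0 \<Omega> s \<sigma>.
         weighted_norm \<Omega> s \<sigma> (weak_jac \<Omega> (T z)) \<le> C (Ap_const s \<sigma>) * weighted_norm \<Omega> s \<sigma> z)"
    using assms(3) unfolding bogovskii_operator_def by blast
  obtain C2 :: "ennreal \<Rightarrow> real" where C2: "\<forall>\<sigma> \<in> Ap 2. \<exists>T.
      unique_continuous_extension \<Omega> B (weighted_Lp0 \<Omega> 2 \<sigma>) (weighted_norm \<Omega> 2 \<sigma>)
        (vec_space (weighted_sobolev0 \<Omega> 2 \<sigma>)) (weighted_sobolev_norm \<Omega> 2 \<sigma>) T \<and>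
      (\<forall>z \<in> weighted_Lp0 \<Omega> 2 \<sigma>.
         weighted_norm \<Omega> 2 \<sigma> (weak_jac \<Omega> (T z)) \<le> C2 (Ap_const 2 \<sigma>) * weighted_norm \<Omega> 2 \<sigma> z)"
    using bog[rule_format, of 2] by auto
  obtain Cp T where T: "unique_continuous_extension \<Omega> B (weighted_Lp0 \<Omega> p (\<lambda>_. 1)) (weighted_norm \<Omega> p (\<lambda>_. 1))
        (vec_space (weighted_sobolev0 \<Omega> p (\<lambda>_. 1))) (weighted_sobolev_norm \<Omega> p (\<lambda>_. 1)) T"
    and Cp: "\<forall>z \<in> weighted_Lp0 \<Omega> p (\<lambda>_. 1).
         weighted_norm \<Omega> p (\<lambda>_. 1) (weak_jac \<Omega> (T z)) \<le> Cp * weighted_norm \<Omega> p (\<lambda>_. 1) z"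
  proof -
    obtain C :: "ennreal \<Rightarrow> real" where "\<forall>\<sigma> \<in> Ap p. \<exists>T.
      unique_continuous_extension \<Omega> B (weighted_Lp0 \<Omega> p \<sigma>) (weighted_norm \<Omega> p \<sigma>)
        (vec_space (weighted_sobolev0 \<Omega> p \<sigma>)) (weighted_sobolev_norm \<Omega> p \<sigma>) T \<and>
      (\<forall>z \<in> weighted_Lp0 \<Omega> p \<sigma>.
         weighted_norm \<Omega> p \<sigma> (weak_jac \<Omega> (T z)) \<le> C (Ap_const p \<sigma>) * weighted_norm \<Omega> p \<sigma> z)"
      using bog[rule_format, of p] p by auto
    then show ?thesis
      using one_in_Ap that by blast
  qed
  \<comment> \<open>The summand \<open>1\<close> only makes \<open>c K\<close> positive if both constants vanish.\<close>
  define c where "c K = 2 powr p * (\<bar>C2 K\<bar> powr 2 + (\<bar>Cp\<bar> powr p + 1)) * (2 * p)" for K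
  have "c K > 0" for K
    unfolding c_def using p by (intro mult_pos_pos add_nonneg_pos) auto
  moreover have "\<exists>T. unique_continuous_extension \<Omega> B
              (orlicz0 \<Omega> (phi_shift p \<delta> A)) (luxemburg \<Omega> (phi_shift p \<delta> A))
              (vec_space (sobolev_orlicz0 \<Omega> (phi_shift p \<delta> A))) (sobolev_orlicz_norm \<Omega> (phi_shift p \<delta> A)) T \<and>
            (\<forall>z \<in> orlicz0 \<Omega> (phi_shift p \<delta> A).
               modular \<Omega> (phi_shift p \<delta> A) (weak_jac \<Omega> (T z))
               \<le> ennreal (c (Ap_const 2 (mu_weight \<Omega> p \<delta> A))) * modular \<Omega> (phi_shift p \<delta> A) z)"
    if \<delta>: "\<delta> \<ge> 0" and A: "A \<in> weighted_Lp \<Omega> p (\<lambda>_. 1)" and \<mu>: "mu_weight \<Omega> p \<delta> A \<in> Ap 2"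
    for \<delta> and A :: "real^'d \<Rightarrow> real^'d^'d"
  proof (intro exI conjI ballI)
    let ?\<mu> = "mu_weight \<Omega> p \<delta> A" and ?\<psi> = "phi_shift p \<delta> A"
    let ?X = "weighted_Lp0 \<Omega> p (\<lambda>_. 1)" and ?Y = "vec_space (weighted_sobolev0 \<Omega> p (\<lambda>_. 1))"
    interpret shifted_modular \<Omega> p \<delta> A
      by unfold_locales (fact \<Omega> p \<delta> A)+
    have X_Lp: "?X \<subseteq> weighted_Lp \<Omega> p (\<lambda>_. 1)"
      by (auto simp: weighted_Lp0_def)
    have dom_X: "norm_dominates ?X N N'"
      if "norm_dominates (weighted_Lp \<Omega> p (\<lambda>_. 1)) N N'" for N N'
      using that X_Lp unfolding norm_dominates_def continuous_at_zero_def by (meson subsetD)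
    show "unique_continuous_extension \<Omega> B (orlicz0 \<Omega> ?\<psi>) (luxemburg \<Omega> ?\<psi>)
        (vec_space (sobolev_orlicz0 \<Omega> ?\<psi>)) (sobolev_orlicz_norm \<Omega> ?\<psi>) T"
      unfolding orlicz0_eq_weighted_Lp0 sobolev_orlicz0_eq_weighted_sobolev0
    proof (rule unique_continuous_extension_change_norms[OF _ _ _ _ _ _ _ T])
      show "linear_closed ?X"
        using p by (intro linear_closed_weighted_Lp0) auto
      show "norm_dominates ?X (weighted_norm \<Omega> p (\<lambda>_. 1)) (luxemburg \<Omega> ?\<psi>)"
        by (rule dom_X[OF norm_dominates_Lp_luxemburg])
      show "norm_dominates ?X (luxemburg \<Omega> ?\<psi>) (weighted_norm \<Omega> p (\<lambda>_. 1))"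
        by (rule dom_X[OF norm_dominates_luxemburg_Lp])
      show "norm_dominates ?Y (weighted_sobolev_norm \<Omega> p (\<lambda>_. 1)) (sobolev_orlicz_norm \<Omega> ?\<psi>)"
        "norm_dominates ?Y (sobolev_orlicz_norm \<Omega> ?\<psi>) (weighted_sobolev_norm \<Omega> p (\<lambda>_. 1))"
        by (rule norm_dominates_sobolev_norms)+
    qed (intro weighted_sobolev_norm_cong_AE sobolev_orlicz_norm_cong_AE \<Omega>'; assumption)+
    fix z assume "z \<in> orlicz0 \<Omega> ?\<psi>"
    then have z: "z \<in> ?X"
      by (simp add: orlicz0_eq_weighted_Lp0)
    obtain T2 where T2: "unique_continuous_extension \<Omega> B (weighted_Lp0 \<Omega> 2 ?\<mu>) (weighted_norm \<Omega> 2 ?\<mu>)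
        (vec_space (weighted_sobolev0 \<Omega> 2 ?\<mu>)) (weighted_sobolev_norm \<Omega> 2 ?\<mu>) T2"
      and T2_le: "\<forall>z \<in> weighted_Lp0 \<Omega> 2 ?\<mu>.
         weighted_norm \<Omega> 2 ?\<mu> (weak_jac \<Omega> (T2 z)) \<le> C2 (Ap_const 2 ?\<mu>) * weighted_norm \<Omega> 2 ?\<mu> z"
      using C2 \<mu> by blast
    have \<mu>_meas: "?\<mu> \<in> borel_measurable (lebesgue_on \<Omega>)"
      by (rule mu_measurable)
    have \<mu>_pos: "AE x in lebesgue_on \<Omega>. 0 < ?\<mu> x"
      using \<mu> \<Omega>' by (auto simp: Ap_def weight_def AE_restrict_space_iff elim: eventually_mono)
    have sub: "?X \<subseteq> weighted_Lp0 \<Omega> 2 ?\<mu>"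
      using weighted_Lp_subset_mu(1) by (auto simp: weighted_Lp0_def)
    \<comment> \<open>Both weighted estimates then concern the same Jacobian.\<close>
    have "AE x in lebesgue_on \<Omega>. T z x = T2 z x"
      using p mu_weight_nonneg \<mu>_meas \<mu>_pos z
      by (intro weighted_extensions_agree[OF \<Omega> _ _ _ _ _ _ _ _ T T2 sub dom_X[OF norm_dominates_Lp_mu]]) auto
    then have jac: "weak_jac \<Omega> (T z) = weak_jac \<Omega> (T2 z)"
      by (rule weak_jac_cong_AE[OF \<Omega>'])
    have "weighted_energy \<Omega> 2 ?\<mu> (weak_jac \<Omega> (T z)) \<le>
        \<bar>C2 (Ap_const 2 ?\<mu>)\<bar> powr 2 * weighted_energy \<Omega> 2 ?\<mu> z"
      unfolding jac using T2_le sub z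
      by (intro weighted_energy_le_of_weighted_norm_le mu_weight_nonneg) auto
    moreover have "weighted_energy \<Omega> p (\<lambda>_. 1) (weak_jac \<Omega> (T z)) \<le> \<bar>Cp\<bar> powr p * weighted_energy \<Omega> p (\<lambda>_. 1) z"
      using Cp z p by (intro weighted_energy_le_of_weighted_norm_le) auto
    then have "weighted_energy \<Omega> p (\<lambda>_. 1) (weak_jac \<Omega> (T z)) \<le> (\<bar>Cp\<bar> powr p + 1) * weighted_energy \<Omega> p (\<lambda>_. 1) z"
      using weighted_energy_nonneg[where \<Omega>=\<Omega> and \<sigma>="\<lambda>_. 1" and s=p and u=z, OF zero_le_one] unfolding distrib_right by linarith
    moreover have "weak_jac \<Omega> (T z) \<in> weighted_Lp \<Omega> p (\<lambda>_. 1)"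
    proof (rule weighted_sobolev0_vecD(2))
      show "T z \<in> ?Y"
        using T z unfolding unique_continuous_extension_def continuous_extension_def by blast
    qed (use p in auto)
    ultimately show "modular \<Omega> ?\<psi> (weak_jac \<Omega> (T z)) \<le> ennreal (c (Ap_const 2 ?\<mu>)) * modular \<Omega> ?\<psi> z"
      unfolding c_def using z X_Lp by (intro modular_le_of_energy_le) auto
  qed
  ultimately show ?thesis
    by blast
qed

end
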